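(* Let $n$ be a positive integer and $X,Y>0$. Then \[ \#\{f\in\Sigma_n: |\Delta(f)|<X,\ h(f)<Y\}\ll \nu(\Sigma_n)\bigl(Y^2+n\bigr)\min\{Y^3,X^{1/2}\}+nY^2 . \]
   Context: For a ring $R$, $V(R)$ is the set of monic cubic polynomials $x^3+tx^2+Ax+B$ with $t\in\{-1,0,1\}$ and $A,B\in R$; $\Delta(f)$ is the discriminant and $h(f)$ is the maximum absolute value of the complex roots of $f$. For $f\in V(\mathbb{Z})$ with $\Delta(f)\ne0$, $\mathrm{ind}(f)$ is the index of $\mathbb{Z}[x]/(f)$ in the ring of integral elements of $\mathbb{Q}[x]/(f)$. $\Sigma_n$ is the set of $f\in V(\mathbb{Z})$ with $\Delta(f)\neq0$ and $n\mid\mathrm{ind}(f)$. $\nu(\Sigma_n)$ is the measure of the closure of $\Sigma_n$ in $V(\hat{\mathbb{Z}})=\{-1,0,1\}\times\hat{\mathbb{Z}}^2$ with respect to the probability measure (uniform in $t$, normalized Haar in $(A,B)$). *)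

theory Defs
  imports Complex_Main "HOL-Computational_Algebra.Polynomial"
begin

text \<open>An element of V(Z) is encoded as the triple (t, A, B) with t in {-1,0,1};
  it stands for the monic cubic x^3 + t x^2 + A x + B.\<close>

definition VZ :: "(int \<times> int \<times> int) set" where
  "VZ = {(t, A, B). t \<in> {-1, 0, 1}}"

definition cubic :: "int \<times> int \<times> int \<Rightarrow> int poly" where
  "cubic f = (case f of (t, A, B) \<Rightarrow> [:B, A, t, 1:])"

definition disc :: "int \<times> int \<times> int \<Rightarrow> int" where
  "disc f = (case f of (t, A, B) \<Rightarrow>
      t^2 * A^2 - 4 * A^3 - 4 * t^3 * B - 27 * B^2 + 18 * t * A * B)"

definition height :: "int \<times> int \<times> int \<Rightarrow> real" where
  "height f = Max {cmod z | z. poly (map_poly of_int (cubic f)) z = 0}"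

text \<open>The ring of integral elements of Q[x]/(f), with Q[x]/(f) realised as the
  rational polynomials of degree < deg f (reduction modulo f): alpha is integral
  iff p(alpha) = 0 in Q[x]/(f) for some monic p in Z[x].\<close>
definition integral_elems :: "int poly \<Rightarrow> rat poly set" where
  "integral_elems f = {\<alpha>. degree \<alpha> < degree f \<and>
     (\<exists>p :: int poly. lead_coeff p = 1 \<and>
        map_poly of_int f dvd pcompose (map_poly of_int p) \<alpha>)}"

text \<open>ind(f) = index of Z[x]/(f) (integer polynomials of degree < deg f) in the
  ring of integral elements: the number of cosets, i.e. of fractional-part
  representatives.\<close>
definition ind :: "int poly \<Rightarrow> nat" where
  "ind f = card ((\<lambda>\<alpha>. map_poly frac \<alpha>) ` integral_elems f)"

definition Sigma :: "nat \<Rightarrow> (int \<times> int \<times> int) set" where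
  "Sigma n = {f \<in> VZ. disc f \<noteq> 0 \<and> n dvd ind (cubic f)}"

text \<open>Measure of the closure of S in V(Zhat) = {-1,0,1} x Zhat^2 (uniform in t,
  normalised Haar in (A,B)): by outer regularity, the infimum over moduli N of
  the measure of the smallest union of residue classes mod N containing S.\<close>
definition nu :: "(int \<times> int \<times> int) set \<Rightarrow> real" where
  "nu S = (INF N \<in> {N :: nat. N \<ge> 1}.
     real (card ((\<lambda>(t, A, B). (t, A mod int N, B mod int N)) ` S)) / (3 * real N ^ 2))"

end

theory Submission
  imports Defs "Jordan_Normal_Form.Char_Poly"
begin

text \<open>
  The index of \<open>f = x\<^sup>3 + t x\<^sup>2 + A x + B\<close> has the form \<open>d\<^sup>3 j\<close>, where for some integer \<open>r\<close> one has
  \<open>d | f''(r)/2\<close>, \<open>d\<^sup>2 j | f'(r)\<close> and \<open>d\<^sup>3 j\<^sup>2 | f(r)\<close>; conversely these divisibilities force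
  \<open>d\<^sup>3 j\<close> to divide the index.  Capping \<open>d\<close> at a suitable divisor of \<open>n\<close> turns \<open>n | ind(f)\<close> into the
  existence of an \<open>r\<close> with \<open>m\<^sup>2 q | f'(r)\<close> and \<open>m\<^sup>3 q\<^sup>2 | f(r)\<close>, where \<open>m\<close> and \<open>q\<close> depend only on
  \<open>3 r + t\<close> and \<open>n\<close>, and \<open>r\<close> is unique modulo \<open>m q\<close>.  So \<open>\<Sigma>\<^sub>n\<close> is, up to vanishing discriminant, a
  disjoint union over classes \<open>(t, r mod m q)\<close> of sets given by one congruence modulo \<open>m\<^sup>2 q \<le> n\<close> for
  \<open>A\<close> and, given \<open>A\<close>, one congruence modulo \<open>m\<^sup>3 q\<^sup>2\<close> for \<open>B\<close>.  Disjointness makes the main terms of the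
  lattice point count add up to exactly the density, so no factor exponential in the number of prime
  divisors of \<open>n\<close> is lost, and there are only \<open>O(n)\<close> classes to contribute error terms.  For fixed
  \<open>A\<close> the condition \<open>|\<Delta>(f)| < X\<close> confines \<open>B\<close> to two intervals of length \<open>O(X\<^sup>1\<^sup>/\<^sup>2)\<close>, since
  \<open>\<Delta>\<close> is quadratic in \<open>B\<close>.
\<close>

subsection \<open>Sums and products of algebraic integers\<close>

text \<open>The integers \<open>d\<close> and \<open>j\<close> come from a triangular basis of the
  maximal order: \<open>1\<close>, an integral linear element with leading coefficient
  \<open>1/d\<close>, and an integral quadratic one with leading coefficient
  \<open>1/(d^2 j)\<close>. As \<open>f\<close> may be reducible, integrality is tested at the three
  complex roots rather than in a number field.

  The obstacle is overlap: for one \<open>f\<close>, several pairs \<open>D\<close>,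
  \<open>J\<close> with n dividing \<open>D^3 J\<close> can pass the divisibility tests. The cap
  selects one pair and one residue class for each \<open>f\<close>.

  As \<open>nu\<close> stands on the larger side of the inequality, a lower bound for it is enough.
  Discriminant zero does no harm there: each residue class for \<open>B\<close> contains values with
  nonzero discriminant.

  The shape of the bound reflects two roundings. Counting the \<open>A\<close> in a progression
  costs an extra 1, which is at most \<open>n\<close> divided by the modulus; hence the summand
  \<open>n\<close> in \<open>Y^2 + n\<close>. Counting the \<open>B\<close> costs O(1) for each of
  the O(Y^2) values of \<open>A\<close> in each of the O(n) classes; hence
  \<open>n Y^2\<close>.\<close>

lemma algebraic_int_if_integer_matrix:
  fixes x :: complex and v :: "nat \<Rightarrow> complex" and c :: "nat \<Rightarrow> nat \<Rightarrow> int"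
  assumes nz: "k < n" "v k \<noteq> 0"
    and eq: "\<And>i. i < n \<Longrightarrow> x * v i = (\<Sum>j<n. of_int (c i j) * v j)"
  shows "algebraic_int x"
proof -
  define M where "M = mat n n (\<lambda>(i, j). c i j)"
  define MC where "MC = (map_mat of_int M :: complex mat)"
  have M: "M \<in> carrier_mat n n" and MC: "MC \<in> carrier_mat n n"
    by (auto simp: M_def MC_def)
  \<comment> \<open>One nonzero entry makes \<open>v\<close> an eigenvector, so \<open>x\<close> is
    a root of the monic integral characteristic polynomial.\<close>
  have "eigenvector MC (vec n v) x"
    unfolding eigenvector_def
  proof (intro conjI)
    show "vec n v \<in> carrier_vec (dim_row MC)" using MC by auto
    show "vec n v \<noteq> 0\<^sub>v (dim_row MC)"
      using nz MC by (auto simp: vec_eq_iff)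
    show "MC *\<^sub>v vec n v = x \<cdot>\<^sub>v vec n v"
    proof (rule eq_vecI)
      fix i assume "i < dim_vec (x \<cdot>\<^sub>v vec n v)"
      then have i: "i < n" by simp
      have "(MC *\<^sub>v vec n v) $ i = (\<Sum>j<n. of_int (c i j) * v j)"
        using i by (simp add: MC_def M_def scalar_prod_def atLeast0LessThan)
      then show "(MC *\<^sub>v vec n v) $ i = (x \<cdot>\<^sub>v vec n v) $ i"
        using i eq[OF i] by simp
    qed (use MC in auto)
  qed
  then have "poly (char_poly MC) x = 0"
    using eigenvalue_root_char_poly[OF MC] eigenvalue_def by blast
  moreover have "char_poly MC = map_poly of_int (char_poly M)"
    unfolding MC_def by (rule of_int_hom.char_poly_hom[OF M])
  moreover have "lead_coeff (char_poly M) = 1"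
    using degree_monic_char_poly[OF M] by simp
  ultimately show ?thesis by (auto simp: algebraic_int_altdef_ipoly)
qed

lemma algebraic_int_if_stable_span:
  fixes x :: complex and v :: "'i \<Rightarrow> complex"
  assumes fin: "finite I" and nz: "k \<in> I" "v k \<noteq> 0"
    and eq: "\<And>i. i \<in> I \<Longrightarrow> \<exists>c :: 'i \<Rightarrow> int. x * v i = (\<Sum>j\<in>I. of_int (c j) * v j)"
  shows "algebraic_int x"
proof -
  obtain h where h: "bij_betw h {..<card I} I"
    using ex_bij_betw_nat_finite[OF fin] by (auto simp: atLeast0LessThan)
  obtain c where c: "\<And>i. i \<in> I \<Longrightarrow> x * v i = (\<Sum>j\<in>I. of_int (c i j) * v j)"
    using eq by metis
  obtain k' where k': "k' < card I" "h k' = k"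
    using h nz(1) by (auto simp: bij_betw_def image_iff) (metis imageE lessThan_iff)
  show ?thesis
  proof (rule algebraic_int_if_integer_matrix[of k' "card I" "\<lambda>i. v (h i)" x "\<lambda>i j. c (h i) (h j)"])
    fix i assume "i < card I"
    then have "h i \<in> I" using h by (auto simp: bij_betw_def)
    then show "x * v (h i) = (\<Sum>j<card I. of_int (c (h i) (h j)) * v (h j))"
      using c sum.reindex_bij_betw[OF h, of "\<lambda>j. of_int (c (h i) j) * v j"] by simp
  qed (use k' nz in auto)
qed

text \<open>The lattice spanned by the monomials \<open>x ^ i * y ^ j\<close>, with exponents below
  the degrees of monic equations for \<open>x\<close> and \<open>y\<close>, is stable under
  multiplication by \<open>x\<close> and by \<open>y\<close>: a top power is rewritten by its
  equation. Hence it is stable under \<open>x + y\<close> and \<open>x * y\<close>.\<close>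

lemma algebraic_int_add_mult:
  fixes x y :: complex
  assumes "algebraic_int x" "algebraic_int y"
  shows "algebraic_int (x + y)" "algebraic_int (x * y)"
proof -
  obtain p where p: "poly (map_poly of_int p) x = 0" "lead_coeff (p :: int poly) = 1"
    using assms(1) by (auto simp: algebraic_int_altdef_ipoly)
  obtain q where q: "poly (map_poly of_int q) y = 0" "lead_coeff (q :: int poly) = 1"
    using assms(2) by (auto simp: algebraic_int_altdef_ipoly)
  define I where "I = {..<degree p} \<times> {..<degree q}"
  define v where "v = (\<lambda>(i, j). x ^ i * y ^ j)"
  define S where "S = {z. \<exists>c :: nat \<times> nat \<Rightarrow> int. z = (\<Sum>j\<in>I. of_int (c j) * v j)}"
  have fin: "finite I" by (simp add: I_def)
  have SI: "z \<in> S" if "z = (\<Sum>j\<in>I. of_int (c j) * v j)" for z c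
    using that by (auto simp: S_def)
  have S0: "0 \<in> S" by (rule SI[of _ "\<lambda>_. 0"]) simp
  have Sadd: "z + w \<in> S" if zw: "z \<in> S" "w \<in> S" for z w
  proof -
    obtain c d where "z = (\<Sum>j\<in>I. of_int (c j) * v j)" "w = (\<Sum>j\<in>I. of_int (d j) * v j)"
      using zw by (auto simp: S_def)
    then show ?thesis by (intro SI[of _ "\<lambda>j. c j + d j"]) (simp add: sum.distrib algebra_simps)
  qed
  have Smult: "of_int k * z \<in> S" if z: "z \<in> S" for z k
  proof -
    obtain c where "z = (\<Sum>j\<in>I. of_int (c j) * v j)"
      using z by (auto simp: S_def)
    then show ?thesis
      by (intro SI[of _ "\<lambda>j. k * c j"]) (simp add: sum_distrib_left algebra_simps)
  qed
  have Ssum: "(\<Sum>j\<in>J. of_int (c j) * f j) \<in> S" if "finite J" "\<And>j. j \<in> J \<Longrightarrow> f j \<in> S"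
    for J :: "'b set" and c f
    using that by (induction J rule: finite_induct) (auto intro: S0 Sadd Smult)
  have Sv: "v j \<in> S" if "j \<in> I" for j
    by (rule SI[of _ "\<lambda>i. if i = j then 1 else 0"])
      (use that fin in \<open>simp add: if_distrib[of of_int] if_distrib[of "\<lambda>a. a * _"] cong: if_cong\<close>)
  have pow: "z ^ degree r = (\<Sum>i<degree r. of_int (- coeff r i) * z ^ i)"
    if r: "poly (map_poly of_int r) z = 0" "lead_coeff (r :: int poly) = 1" for z :: complex and r
  proof -
    have "0 = (\<Sum>i\<le>degree r. of_int (coeff r i) * z ^ i)"
      using r by (simp add: poly_altdef degree_map_poly coeff_map_poly)
    also have "{..degree r} = insert (degree r) {..<degree r}" by auto
    finally show ?thesis using r(2) by (simp add: sum_negf add_eq_0_iff)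
  qed
  have xv: "x * v j \<in> S" if j_I: "j \<in> I" for j
  proof -
    obtain a b where j: "j = (a, b)" "a < degree p" "b < degree q"
      using j_I by (auto simp: I_def)
    show ?thesis
    proof (cases "Suc a < degree p")
      case True
      then show ?thesis using Sv[of "(Suc a, b)"] j by (simp add: I_def v_def mult_ac)
    next
      case False
      then have "Suc a = degree p" using j by simp
      then have "x * v j = x ^ degree p * y ^ b" by (simp add: j v_def flip: power_Suc)
      also have "\<dots> = (\<Sum>i<degree p. of_int (- coeff p i) * v (i, b))"
        by (subst pow[OF p]) (simp add: sum_distrib_right sum_distrib_left v_def mult_ac flip: sum_negf)
      also have "\<dots> \<in> S" using j by (intro Ssum Sv) (auto simp: I_def)
      finally show ?thesis .
    qed
  qed
  have yv: "y * v j \<in> S" if j_I: "j \<in> I" for j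
  proof -
    obtain a b where j: "j = (a, b)" "a < degree p" "b < degree q"
      using j_I by (auto simp: I_def)
    show ?thesis
    proof (cases "Suc b < degree q")
      case True
      then show ?thesis using Sv[of "(a, Suc b)"] j by (simp add: I_def v_def mult_ac)
    next
      case False
      then have "Suc b = degree q" using j by simp
      then have "y * v j = x ^ a * y ^ degree q" by (simp add: j v_def flip: power_Suc)
      also have "\<dots> = (\<Sum>i<degree q. of_int (- coeff q i) * v (a, i))"
        by (subst pow[OF q]) (simp add: sum_distrib_left v_def mult_ac flip: sum_negf)
      also have "\<dots> \<in> S" using j by (intro Ssum Sv) (auto simp: I_def)
      finally show ?thesis .
    qed
  qed
  have xS: "x * z \<in> S" if z: "z \<in> S" for z
  proof -
    obtain c where "z = (\<Sum>j\<in>I. of_int (c j) * v j)"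
      using z by (auto simp: S_def)
    then have "x * z = (\<Sum>j\<in>I. of_int (c j) * (x * v j))" by (simp add: sum_distrib_left mult_ac)
    then show ?thesis using Ssum[OF fin xv] by simp
  qed
  have dp: "degree p > 0"
    using p by (intro Nat.gr0I) (auto elim!: degree_eq_zeroE)
  have dq: "degree q > 0"
    using q by (intro Nat.gr0I) (auto elim!: degree_eq_zeroE)
  have k: "(0, 0) \<in> I" "v (0, 0) \<noteq> 0" using dp dq by (auto simp: I_def v_def)
  have fact: "algebraic_int z" if "\<And>j. j \<in> I \<Longrightarrow> z * v j \<in> S" for z
    using algebraic_int_if_stable_span[where v = v, OF fin k] that by (auto simp: S_def)
  show "algebraic_int (x + y)"
    by (rule fact) (use xv yv Sadd in \<open>simp add: distrib_right\<close>)
  show "algebraic_int (x * y)"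
    by (rule fact) (use xS yv in \<open>simp add: mult.assoc\<close>)
qed

lemma algebraic_int_diff:
  fixes x y :: complex
  assumes "algebraic_int x" "algebraic_int y"
  shows "algebraic_int (x - y)"
  using algebraic_int_add_mult(1)[of x "- y"] assms by simp

lemma algebraic_int_power:
  fixes x :: complex
  assumes "algebraic_int x"
  shows "algebraic_int (x ^ n)"
  by (induction n) (auto intro: algebraic_int_add_mult assms)

lemmas algebraic_int_closed =
  algebraic_int_add_mult algebraic_int_diff algebraic_int_power algebraic_int_of_int

subsection \<open>The cubic algebra through its complex embeddings\<close>

text \<open>Vieta's relations list the roots without assuming irreducibility. The roots need not be
  conjugate, so every integrality condition below is imposed at all three.\<close>

locale cubic_roots =
  fixes t A B :: int and z1 z2 z3 :: complex
  assumes vieta: "of_int t = - (z1 + z2 + z3)" "of_int A = z1 * z2 + z1 * z3 + z2 * z3"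
      "of_int B = - (z1 * z2 * z3)"
    and disc_nz: "disc (t, A, B) \<noteq> 0"
begin

lemma poly_factor:
  "map_poly of_int (cubic (t, A, B)) = [:- z1, 1:] * [:- z2, 1:] * [:- z3, 1:]"
  by (simp add: cubic_def hom_distribs vieta algebra_simps)

lemma root_iff: "poly (map_poly of_int (cubic (t, A, B))) z = 0 \<longleftrightarrow> z \<in> {z1, z2, z3}"
proof -
  have "poly (map_poly of_int (cubic (t, A, B))) z = (z - z1) * (z - z2) * (z - z3)"
    by (simp only: poly_factor poly_mult poly_pCons poly_0) simp
  then show ?thesis by auto
qed

lemma root_eq:
  assumes "z \<in> {z1, z2, z3}"
  shows "z ^ 3 + of_int t * z ^ 2 + of_int A * z + of_int B = 0"
  using assms unfolding vieta by (auto simp: algebra_simps power2_eq_square power3_eq_cube)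

lemma disc_eq: "of_int (disc (t, A, B)) = ((z1 - z2) * (z1 - z3) * (z2 - z3)) ^ 2"
  by (simp add: disc_def vieta) (simp add: algebra_simps power2_eq_square power3_eq_cube)

lemma algebraic_int_root_poly:
  assumes "z \<in> {z1, z2, z3}" shows "algebraic_int z"
proof -
  have "lead_coeff (cubic (t, A, B)) = 1" by (simp add: cubic_def)
  then show ?thesis
    using assms root_iff algebraic_int_altdef_ipoly by blast
qed

text \<open>For the converse direction, the product of monic equations for the three values vanishes
  at all embeddings at once. The cubic then divides its composition with \<open>\<alpha>\<close>
  over the complex numbers, and this divisibility descends to the rationals.\<close>

lemma integral_elems_iff:
  "\<alpha> \<in> integral_elems (cubic (t, A, B)) \<longleftrightarrow>
    degree \<alpha> < 3 \<and> (\<forall>z\<in>{z1, z2, z3}. algebraic_int (poly (map_poly of_rat \<alpha>) z))"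
proof -
  interpret rat_hom: map_poly_comm_ring_hom "of_rat :: rat \<Rightarrow> complex" ..
  have deg: "degree (cubic (t, A, B)) = 3" by (simp add: cubic_def)
  have rat: "map_poly (of_rat :: rat \<Rightarrow> complex) (map_poly of_int p) = map_poly of_int p" for p
    by (simp add: map_poly_map_poly o_def)
  have comp: "map_poly (of_rat :: rat \<Rightarrow> complex) (map_poly of_int p \<circ>\<^sub>p \<alpha>)
      = map_poly of_int p \<circ>\<^sub>p map_poly of_rat \<alpha>" for p
    by (simp add: of_rat_hom.map_poly_pcompose rat)
  have "(\<exists>p :: int poly. lead_coeff p = 1 \<and>
        map_poly of_int (cubic (t, A, B)) dvd pcompose (map_poly of_int p) \<alpha>)
    \<longleftrightarrow> (\<forall>z\<in>{z1, z2, z3}. algebraic_int (poly (map_poly of_rat \<alpha>) z))" (is "?L \<longleftrightarrow> ?R")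
  proof
    assume ?L
    then obtain p q where p: "lead_coeff p = 1"
      "pcompose (map_poly of_int p) \<alpha> = map_poly of_int (cubic (t, A, B)) * q"
      by (auto elim!: dvdE)
    show ?R
    proof
      fix z assume z: "z \<in> {z1, z2, z3}"
      have "poly (map_poly of_int p) (poly (map_poly of_rat \<alpha>) z)
          = poly (map_poly of_rat (map_poly of_int p \<circ>\<^sub>p \<alpha>)) z"
        by (simp add: comp poly_pcompose)
      also have "\<dots> = poly (map_poly of_int (cubic (t, A, B))) z * poly (map_poly of_rat q) z"
        unfolding p(2) by (simp add: rat_hom.hom_mult rat)
      also have "\<dots> = 0" using z root_iff by simp
      finally show "algebraic_int (poly (map_poly of_rat \<alpha>) z)"
        using p(1) algebraic_int_altdef_ipoly by blast
    qed
  next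
    assume R: ?R
    have "\<exists>p :: int poly. lead_coeff p = 1 \<and> [:- z, 1:] dvd map_poly of_int p \<circ>\<^sub>p map_poly of_rat \<alpha>"
      if "z \<in> {z1, z2, z3}" for z
      using R that unfolding algebraic_int_altdef_ipoly
      by (metis poly_eq_0_iff_dvd poly_pcompose)
    then obtain p where p: "\<And>z. z \<in> {z1, z2, z3} \<Longrightarrow> lead_coeff (p z :: int poly) = 1"
      "\<And>z. z \<in> {z1, z2, z3} \<Longrightarrow> [:- z, 1:] dvd map_poly of_int (p z) \<circ>\<^sub>p map_poly of_rat \<alpha>"
      by metis
    define P where "P = p z1 * p z2 * p z3"
    have "map_poly of_int (cubic (t, A, B)) dvd
      (map_poly of_int P \<circ>\<^sub>p map_poly of_rat \<alpha> :: complex poly)"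
      unfolding poly_factor P_def hom_distribs pcompose_mult
      by (intro mult_dvd_mono p) auto
    then have "map_poly (of_rat :: rat \<Rightarrow> complex) (map_poly of_int (cubic (t, A, B)))
        dvd map_poly of_rat (map_poly of_int P \<circ>\<^sub>p \<alpha>)"
      by (simp add: comp rat)
    then have "map_poly of_int (cubic (t, A, B)) dvd map_poly of_int P \<circ>\<^sub>p \<alpha>"
      by (rule of_rat_hom.dvd_map_poly_hom_imp_dvd)
    moreover have "lead_coeff P = 1" using p(1) by (simp add: P_def lead_coeff_mult)
    ultimately show ?L by blast
  qed
  then show ?thesis by (simp add: integral_elems_def deg)
qed

end

lemma cubic_roots_exist:
  assumes "disc (t, A, B) \<noteq> 0"
  shows "\<exists>z1 z2 z3. cubic_roots t A B z1 z2 z3"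
proof -
  define F where "F = [:of_int B, of_int A, of_int t, 1 :: complex:]"
  have "\<not> constant (poly F)" by (simp add: F_def constant_degree)
  then obtain z1 where z1: "poly F z1 = 0" using fundamental_theorem_of_algebra by blast
  define G where "G = [:of_int A + of_int t * z1 + z1 ^ 2, of_int t + z1, 1 :: complex:]"
  have "\<not> constant (poly G)" by (simp add: G_def constant_degree)
  then obtain z2 where z2: "poly G z2 = 0" using fundamental_theorem_of_algebra by blast
  define z3 where "z3 = - (of_int t + z1 + z2)"
  have "of_int A + of_int t * z1 + z1 ^ 2 + z2 * (of_int t + z1 + z2) = 0"
    using z2 by (simp add: G_def)
  moreover have "of_int A - (z1 * z2 + z1 * z3 + z2 * z3)
      = of_int A + of_int t * z1 + z1 ^ 2 + z2 * (of_int t + z1 + z2)"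
    by (simp add: z3_def algebra_simps power2_eq_square)
  ultimately have A: "of_int A = z1 * z2 + z1 * z3 + z2 * z3" by simp
  have "of_int B + z1 * (of_int A + z1 * (of_int t + z1)) = 0"
    using z1 by (simp add: F_def)
  moreover have "of_int B + z1 * z2 * z3 = of_int B + z1 * (of_int A + z1 * (of_int t + z1))"
    unfolding A by (simp add: z3_def algebra_simps)
  ultimately have "of_int B + z1 * z2 * z3 = 0" by metis
  then have "of_int B = - (z1 * z2 * z3)" by (simp only: eq_neg_iff_add_eq_0)
  then show ?thesis using A assms
    by (intro exI[of _ z1] exI[of _ z2] exI[of _ z3]) (simp add: cubic_roots_def z3_def)
qed

subsection \<open>The index as a product of two denominators\<close>

lemma algebraic_int_of_rat_iff: "algebraic_int (of_rat x :: complex) \<longleftrightarrow> x \<in> \<int>"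
proof
  assume "algebraic_int (of_rat x :: complex)"
  then have "(of_rat x :: complex) \<in> \<int>" by (rule rational_algebraic_int_is_int) auto
  then show "x \<in> \<int>" by (metis Ints_cases Ints_of_int of_rat_eq_iff of_rat_of_int_eq)
qed (auto elim: Ints_cases)

text \<open>Division with remainder by the least positive element \<open>g / E\<close> shows that it
  generates \<open>H\<close>. As 1 lies in \<open>H\<close>, \<open>E\<close> is a multiple of
  \<open>g\<close>, so the generator is \<open>1 / d\<close> with \<open>d = E / g\<close>.\<close>

lemma rat_subgroup_cyclic:
  fixes H :: "rat set" and D :: int
  assumes one: "1 \<in> H" and diff: "\<And>x y. x \<in> H \<Longrightarrow> y \<in> H \<Longrightarrow> x - y \<in> H"
    and bdd: "\<And>x. x \<in> H \<Longrightarrow> of_int D * x \<in> \<int>" and D: "D \<noteq> 0"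
  shows "\<exists>d::nat. d > 0 \<and> (\<forall>x. x \<in> H \<longleftrightarrow> of_nat d * x \<in> \<int>)"
proof -
  have zero: "0 \<in> H" using diff[OF one one] by simp
  have neg: "- x \<in> H" if "x \<in> H" for x using diff[OF zero that] by simp
  have add: "x + y \<in> H" if "x \<in> H" "y \<in> H" for x y using diff[OF that(1) neg[OF that(2)]] by simp
  have nmul: "of_nat k * x \<in> H" if "x \<in> H" for k x
    by (induction k) (auto simp: distrib_right intro: zero add that)
  have mul: "of_int k * x \<in> H" if "x \<in> H" for k x
  proof (cases "k \<ge> 0")
    case True
    then show ?thesis using nmul[OF that, of "nat k"] by simp
  next
    case False
    then show ?thesis using neg[OF nmul[OF that, of "nat (- k)"]] by simp
  qed
  define E where "E = nat \<bar>D\<bar>"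
  have E: "E > 0" using D by (simp add: E_def)
  have bddE: "of_nat E * x \<in> \<int>" if "x \<in> H" for x
    using bdd[OF that] by (auto simp: E_def abs_if)
  define S where "S = {k::nat. k > 0 \<and> of_nat k / of_nat E \<in> H}"
  define g where "g = (LEAST k. k \<in> S)"
  have "E \<in> S" using E one by (simp add: S_def)
  then have gS: "g \<in> S" unfolding g_def by (rule LeastI)
  have gmin: "k \<notin> S" if "k < g" for k using that not_less_Least unfolding g_def by blast
  have g: "g > 0" "of_nat g / of_nat E \<in> H" using gS by (auto simp: S_def)
  have key: "\<exists>k. of_nat E * x = of_int k * of_nat g" if x: "x \<in> H" for x
  proof -
    obtain m where m: "of_nat E * x = of_int m" using bddE[OF x] by (auto elim: Ints_cases)
    have "x - of_int (m div int g) * (of_nat g / of_nat E) \<in> H"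
      by (intro diff x mul g)
    moreover have "x - of_int (m div int g) * (of_nat g / of_nat E) = of_int (m mod int g) / of_nat E"
    proof -
      have "of_int m = (of_int (m div int g) * of_nat g + of_int (m mod int g) :: rat)"
        by (metis div_mult_mod_eq of_int_add of_int_mult of_int_of_nat_eq)
      then show ?thesis using E m by (simp add: field_simps)
    qed
    ultimately have "of_nat (nat (m mod int g)) / of_nat E \<in> H" using g by simp
    moreover have "nat (m mod int g) < g" using g by (simp add: nat_less_iff)
    ultimately have "m mod int g = 0" using gmin[of "nat (m mod int g)"] g
      by (auto simp: S_def) (metis g(1) of_nat_0_less_iff order_le_less pos_mod_sign)
    then have "m = (m div int g) * int g" by auto
    then show ?thesis using m by (metis of_int_mult of_int_of_nat_eq)
  qed
  obtain d where d: "of_nat E = of_int d * (of_nat g :: rat)" using key[OF one] by auto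
  have d0: "d > 0"
  proof (rule ccontr)
    assume "\<not> d > 0"
    then have "of_int d * (of_nat g :: rat) \<le> 0" by (simp add: mult_nonpos_nonneg)
    then show False using d E by simp
  qed
  have "x \<in> H \<longleftrightarrow> of_nat (nat d) * x \<in> \<int>" for x
  proof
    assume "x \<in> H"
    then obtain k where "of_nat E * x = of_int k * of_nat g" using key by blast
    then have "of_int d * x = of_int k" using d g(1) by simp
    then show "of_nat (nat d) * x \<in> \<int>" using d0 by simp
  next
    assume "of_nat (nat d) * x \<in> \<int>"
    then obtain k where k: "of_int d * x = of_int k" using d0 by (auto elim: Ints_cases)
    have "x = of_int k * (of_nat g / of_nat E)"
      unfolding d using d0 g(1) k by (simp add: field_simps)
    then show "x \<in> H" using mul[OF g(2)] by simp
  qed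
  then show ?thesis using d0 by (intro exI[of _ "nat d"]) auto
qed

context cubic_roots
begin

definition is_integral :: "rat \<Rightarrow> rat \<Rightarrow> rat \<Rightarrow> bool" where
  "is_integral c0 c1 c2 \<longleftrightarrow>
    (\<forall>z\<in>{z1, z2, z3}. algebraic_int (of_rat c0 + of_rat c1 * z + of_rat c2 * z ^ 2))"

lemma is_integral_diff:
  assumes "is_integral c0 c1 c2" "is_integral e0 e1 e2"
  shows "is_integral (c0 - e0) (c1 - e1) (c2 - e2)"
  unfolding is_integral_def
proof
  fix z assume z: "z \<in> {z1, z2, z3}"
  have "of_rat (c0 - e0) + of_rat (c1 - e1) * z + of_rat (c2 - e2) * z ^ 2
      = (of_rat c0 + of_rat c1 * z + of_rat c2 * z ^ 2) - (of_rat e0 + of_rat e1 * z + of_rat e2 * z ^ 2)"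
    by (simp add: of_rat_diff algebra_simps)
  moreover have "algebraic_int (of_rat c0 + of_rat c1 * z + of_rat c2 * z ^ 2)"
    "algebraic_int (of_rat e0 + of_rat e1 * z + of_rat e2 * z ^ 2)"
    using assms z unfolding is_integral_def by blast+
  ultimately show "algebraic_int (of_rat (c0 - e0) + of_rat (c1 - e1) * z + of_rat (c2 - e2) * z ^ 2)"
    by (simp only: algebraic_int_diff)
qed

lemma is_integral_ints:
  assumes "c0 \<in> \<int>" "c1 \<in> \<int>" "c2 \<in> \<int>" shows "is_integral c0 c1 c2"
proof -
  obtain k0 k1 k2 where k: "c0 = of_int k0" "c1 = of_int k1" "c2 = of_int k2"
    using assms by (meson Ints_cases)
  show ?thesis
    unfolding is_integral_def k of_rat_of_int_eq
    by (intro ballI algebraic_int_add_mult algebraic_int_of_int algebraic_int_power algebraic_int_root_poly)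
qed

lemma is_integral_0: "is_integral 0 0 0" by (rule is_integral_ints) auto

lemma is_integral_add:
  assumes "is_integral c0 c1 c2" "is_integral e0 e1 e2"
  shows "is_integral (c0 + e0) (c1 + e1) (c2 + e2)"
  using is_integral_diff[OF assms(1) is_integral_diff[OF is_integral_0 assms(2)]] by simp

lemma is_integral_const_iff: "is_integral c0 0 0 \<longleftrightarrow> c0 \<in> \<int>"
  by (auto simp: is_integral_def algebraic_int_of_rat_iff)

lemma algebraic_int_vandermonde: "algebraic_int ((z1 - z2) * (z1 - z3) * (z2 - z3))"
  by (intro algebraic_int_add_mult(2) algebraic_int_diff algebraic_int_root_poly) simp_all

text \<open>Eliminating the other coefficients yields \<open>c\<close> times the Vandermonde product
  as an algebraic integer. Multiplying by that product once more gives a rational number, hence an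
  integer.\<close>

lemma disc_mult_Ints:
  assumes "algebraic_int w" "of_rat c * ((z1 - z2) * (z1 - z3) * (z2 - z3)) = w"
  shows "of_int (disc (t, A, B)) * c \<in> \<int>"
proof -
  have "of_rat (of_int (disc (t, A, B)) * c) = w * ((z1 - z2) * (z1 - z3) * (z2 - z3))"
    unfolding of_rat_mult of_rat_of_int_eq disc_eq assms(2)[symmetric] by (simp add: power2_eq_square)
  also have "algebraic_int \<dots>"
    by (rule algebraic_int_add_mult(2)[OF assms(1) algebraic_int_vandermonde])
  finally show ?thesis by (simp only: algebraic_int_of_rat_iff)
qed

text \<open>\<open>d1\<close> and \<open>d2\<close> are the common denominators of the leading
  coefficients of integral elements of degree at most 1 and at most 2. These coefficients form
  groups, and elimination at the roots (Cramer's rule) bounds their denominators by the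
  discriminant.\<close>

lemma is_integral_denominators:
  shows "\<exists>d1::nat. d1 > 0 \<and> (\<forall>c. (\<exists>c0. is_integral c0 c 0) \<longleftrightarrow> of_nat d1 * c \<in> \<int>)"
    and "\<exists>d2::nat. d2 > 0 \<and> (\<forall>c. (\<exists>c0 c1. is_integral c0 c1 c) \<longleftrightarrow> of_nat d2 * c \<in> \<int>)"
proof -
  have one: "is_integral 0 1 0" "is_integral 0 0 1" by (rule is_integral_ints; simp)+
  have b1: "of_int (disc (t, A, B)) * c \<in> \<int>" if "is_integral c0 c 0" for c0 c
  proof (rule disc_mult_Ints)
    have comb: "algebraic_int ((w1 - w2) * ((z1 - z3) * (z2 - z3)))"
      if "algebraic_int w1" "algebraic_int w2" for w1 w2
      by (intro algebraic_int_closed that algebraic_int_root_poly[of z1]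
        algebraic_int_root_poly[of z2] algebraic_int_root_poly[of z3]) auto
    show "algebraic_int (((of_rat c0 + of_rat c * z1) - (of_rat c0 + of_rat c * z2)) * ((z1 - z3) * (z2 - z3)))"
      by (rule comb) (use that in \<open>simp_all add: is_integral_def\<close>)
  qed (simp add: algebra_simps)
  have b2: "of_int (disc (t, A, B)) * c \<in> \<int>" if i: "is_integral c0 c1 c" for c0 c1 c
  proof (rule disc_mult_Ints)
    have comb: "algebraic_int (w1 * (z2 - z3) - w2 * (z1 - z3) + w3 * (z1 - z2))"
      if "algebraic_int w1" "algebraic_int w2" "algebraic_int w3" for w1 w2 w3
      by (intro algebraic_int_closed that algebraic_int_root_poly[of z1]
        algebraic_int_root_poly[of z2] algebraic_int_root_poly[of z3]) auto
    show "algebraic_int ((of_rat c0 + of_rat c1 * z1 + of_rat c * z1 ^ 2) * (z2 - z3)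
        - (of_rat c0 + of_rat c1 * z2 + of_rat c * z2 ^ 2) * (z1 - z3)
        + (of_rat c0 + of_rat c1 * z3 + of_rat c * z3 ^ 2) * (z1 - z2))"
      by (rule comb) (use i in \<open>simp_all add: is_integral_def\<close>)
  qed (simp add: algebra_simps power2_eq_square)
  have "\<exists>d::nat. d > 0 \<and> (\<forall>x. x \<in> {c. \<exists>c0. is_integral c0 c 0} \<longleftrightarrow> of_nat d * x \<in> \<int>)"
  proof (rule rat_subgroup_cyclic[OF _ _ _ disc_nz])
    fix x y assume "x \<in> {c. \<exists>c0. is_integral c0 c 0}" "y \<in> {c. \<exists>c0. is_integral c0 c 0}"
    then show "x - y \<in> {c. \<exists>c0. is_integral c0 c 0}" using is_integral_diff[of _ _ 0 _ _ 0] by fastforce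
  qed (use one b1 in auto)
  then show "\<exists>d1::nat. d1 > 0 \<and> (\<forall>c. (\<exists>c0. is_integral c0 c 0) \<longleftrightarrow> of_nat d1 * c \<in> \<int>)"
    by simp
  have "\<exists>d::nat. d > 0 \<and> (\<forall>x. x \<in> {c. \<exists>c0 c1. is_integral c0 c1 c} \<longleftrightarrow> of_nat d * x \<in> \<int>)"
  proof (rule rat_subgroup_cyclic[OF _ _ _ disc_nz])
    fix x y assume "x \<in> {c. \<exists>c0 c1. is_integral c0 c1 c}" "y \<in> {c. \<exists>c0 c1. is_integral c0 c1 c}"
    then show "x - y \<in> {c. \<exists>c0 c1. is_integral c0 c1 c}" using is_integral_diff by blast
  qed (use one b2 in auto)
  then show "\<exists>d2::nat. d2 > 0 \<and> (\<forall>c. (\<exists>c0 c1. is_integral c0 c1 c) \<longleftrightarrow> of_nat d2 * c \<in> \<int>)"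
    by simp
qed

lemma integral_elems_eq:
  "integral_elems (cubic (t, A, B)) = (\<lambda>(c0, c1, c2). [:c0, c1, c2:]) ` {(c0, c1, c2). is_integral c0 c1 c2}"
proof -
  have val: "poly (map_poly of_rat [:c0, c1, c2:]) z = of_rat c0 + of_rat c1 * z + of_rat c2 * z ^ 2"
    for c0 c1 c2 and z :: complex
    by (simp add: hom_distribs algebra_simps power2_eq_square)
  have mem: "[:c0, c1, c2:] \<in> integral_elems (cubic (t, A, B)) \<longleftrightarrow> is_integral c0 c1 c2" for c0 c1 c2
    unfolding integral_elems_iff is_integral_def val by (simp del: ball_simps)
  have deg: "\<exists>c0 c1 c2. \<alpha> = [:c0, c1, c2:]" if "degree \<alpha> < 3" for \<alpha> :: "rat poly"
  proof -
    have "coeff \<alpha> (Suc (Suc (Suc n))) = 0" for n using that by (intro coeff_eq_0) simp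
    then have "\<alpha> = [:coeff \<alpha> 0, coeff \<alpha> 1, coeff \<alpha> 2:]"
      by (intro poly_eqI) (simp add: coeff_pCons numeral_2_eq_2 split: nat.split)
    then show ?thesis by blast
  qed
  show ?thesis
  proof (intro equalityI subsetI)
    fix \<alpha> assume \<alpha>: "\<alpha> \<in> integral_elems (cubic (t, A, B))"
    then obtain c0 c1 c2 where c: "\<alpha> = [:c0, c1, c2:]" using deg integral_elems_iff by blast
    then show "\<alpha> \<in> (\<lambda>(c0, c1, c2). [:c0, c1, c2:]) ` {(c0, c1, c2). is_integral c0 c1 c2}"
      using \<alpha> mem by (intro image_eqI[of _ _ "(c0, c1, c2)"]) auto
  next
    fix \<alpha> assume "\<alpha> \<in> (\<lambda>(c0, c1, c2). [:c0, c1, c2:]) ` {(c0, c1, c2). is_integral c0 c1 c2}"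
    then show "\<alpha> \<in> integral_elems (cubic (t, A, B))" using mem by fast
  qed
qed

text \<open>Filtering by degree splits the index into the indices of the groups of leading
  coefficients. Degree 0 contributes nothing, since a rational integral constant is an
  integer.\<close>

lemma ind_eq:
  assumes d1: "d1 > 0" "\<And>c. (\<exists>c0. is_integral c0 c 0) \<longleftrightarrow> of_nat d1 * c \<in> \<int>"
    and d2: "d2 > 0" "\<And>c. (\<exists>c0 c1. is_integral c0 c1 c) \<longleftrightarrow> of_nat d2 * c \<in> \<int>"
  shows "ind (cubic (t, A, B)) = d1 * d2"
proof -
  define E where "E = {(c0, c1, c2). is_integral c0 c1 c2 \<and> c0 \<in> {0..<1} \<and> c1 \<in> {0..<1} \<and> c2 \<in> {0..<1}}"
  have fr: "map_poly frac [:c0, c1, c2:] = [:frac c0, frac c1, frac c2:]" for c0 c1 c2 :: rat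
    by (intro poly_eqI) (auto simp: coeff_map_poly coeff_pCons split: nat.splits)
  have "map_poly frac ` integral_elems (cubic (t, A, B)) = (\<lambda>(c0, c1, c2). [:c0, c1, c2:]) ` E"
  proof (intro equalityI subsetI)
    fix p assume "p \<in> map_poly frac ` integral_elems (cubic (t, A, B))"
    then obtain c0 c1 c2 where c: "is_integral c0 c1 c2" "p = [:frac c0, frac c1, frac c2:]"
      by (auto simp: integral_elems_eq fr)
    have "is_integral (frac c0) (frac c1) (frac c2)"
      unfolding frac_def by (intro is_integral_diff c is_integral_ints) auto
    then have "(frac c0, frac c1, frac c2) \<in> E" by (simp add: E_def frac_lt_1)
    then show "p \<in> (\<lambda>(c0, c1, c2). [:c0, c1, c2:]) ` E" unfolding c(2) by (rule rev_image_eqI) simp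
  next
    fix p assume "p \<in> (\<lambda>(c0, c1, c2). [:c0, c1, c2:]) ` E"
    then obtain c0 c1 c2 where c: "(c0, c1, c2) \<in> E" "p = [:c0, c1, c2:]" by auto
    then have "p = map_poly frac [:c0, c1, c2:]"
      unfolding fr by (auto simp: E_def frac_eq[THEN iffD2])
    moreover have "[:c0, c1, c2:] \<in> integral_elems (cubic (t, A, B))"
      using c(1) unfolding integral_elems_eq E_def by (auto simp: image_iff)
    ultimately show "p \<in> map_poly frac ` integral_elems (cubic (t, A, B))" by blast
  qed
  moreover have "inj_on (\<lambda>(c0, c1, c2). [:c0, c1, c2:]) E" by (auto simp: inj_on_def)
  ultimately have "ind (cubic (t, A, B)) = card E" unfolding ind_def by (simp add: card_image)
  also have "\<dots> = card ({0..<int d2} \<times> {0..<int d1})"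
  proof (rule bij_betw_same_card)
    \<comment> \<open>\<open>c2\<close> runs through multiples of \<open>1 / d2\<close>. For fixed
      \<open>c2\<close>, the possible \<open>c1\<close> form a coset of the multiples of
      \<open>1 / d1\<close>, which is why a floor is taken; \<open>c0\<close> is then fixed modulo
      1.\<close>
    show "bij_betw (\<lambda>(c0, c1, c2). (\<lfloor>of_nat d2 * c2\<rfloor>, \<lfloor>of_nat d1 * c1\<rfloor>)) E ({0..<int d2} \<times> {0..<int d1})"
      unfolding bij_betw_def
    proof (intro conjI)
      show "inj_on (\<lambda>(c0, c1, c2). (\<lfloor>of_nat d2 * c2\<rfloor>, \<lfloor>of_nat d1 * c1\<rfloor>)) E"
      proof (rule inj_onI)
        fix x y
        assume x: "x \<in> E" and y: "y \<in> E"
          and fl_eq: "(\<lambda>(c0, c1, c2). (\<lfloor>of_nat d2 * c2\<rfloor>, \<lfloor>of_nat d1 * c1\<rfloor>)) x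
            = (\<lambda>(c0, c1, c2). (\<lfloor>of_nat d2 * c2\<rfloor>, \<lfloor>of_nat d1 * c1\<rfloor>)) y"
        obtain c0 c1 c2 e0 e1 e2 where xy: "x = (c0, c1, c2)" "y = (e0, e1, e2)"
          by (metis prod_cases3)
        have E: "(c0, c1, c2) \<in> E" "(e0, e1, e2) \<in> E"
          and fl: "\<lfloor>of_nat d2 * c2\<rfloor> = \<lfloor>of_nat d2 * e2\<rfloor>" "\<lfloor>of_nat d1 * c1\<rfloor> = \<lfloor>of_nat d1 * e1\<rfloor>"
          using x y fl_eq by (auto simp: xy)
        have "of_nat d2 * c2 \<in> \<int>" "of_nat d2 * e2 \<in> \<int>"
          using E d2(2) unfolding E_def by blast+
        then have "of_nat d2 * c2 = of_nat d2 * e2" using fl(1) by (metis Ints_cases floor_of_int)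
        then have 2: "c2 = e2" using d2(1) by simp
        have int: "is_integral (c0 - e0) (c1 - e1) 0"
          using is_integral_diff[of c0 c1 c2 e0 e1 e2] E 2 by (simp add: E_def)
        then have "of_nat d1 * (c1 - e1) \<in> \<int>" using d1(2) by blast
        then obtain k where k: "of_nat d1 * c1 = of_nat d1 * e1 + of_int k"
          by (auto elim!: Ints_cases simp: algebra_simps)
        then have "k = 0" using fl(2) by simp
        then have 1: "c1 = e1" using k d1(1) by simp
        have "c0 - e0 \<in> \<int>" using int 1 is_integral_const_iff by simp
        then obtain m where m: "c0 - e0 = of_int m" by (auto elim: Ints_cases)
        have "\<bar>c0 - e0\<bar> < 1" using E by (auto simp: E_def abs_if)
        then have "m = 0" unfolding m by (simp flip: of_int_abs)
        then have "c0 = e0" using m by simp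
        then show "x = y" using 1 2 by (simp add: xy)
      qed
      show "(\<lambda>(c0, c1, c2). (\<lfloor>of_nat d2 * c2\<rfloor>, \<lfloor>of_nat d1 * c1\<rfloor>)) ` E = {0..<int d2} \<times> {0..<int d1}"
      proof (intro equalityI subsetI)
        have *: "\<lfloor>of_nat d * c\<rfloor> \<in> {0..<int d}" if "0 \<le> c" "c < 1" "d > 0" for d and c :: rat
        proof -
          have "of_nat d * c < of_nat d * 1" using that by (intro mult_strict_left_mono) auto
          then show ?thesis using that by (simp add: floor_less_iff)
        qed
        fix x assume "x \<in> (\<lambda>(c0, c1, c2). (\<lfloor>of_nat d2 * c2\<rfloor>, \<lfloor>of_nat d1 * c1\<rfloor>)) ` E"
        then show "x \<in> {0..<int d2} \<times> {0..<int d1}"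
          using * d1(1) d2(1) by (fastforce simp: E_def)
      next
        fix x assume "x \<in> {0..<int d2} \<times> {0..<int d1}"
        then obtain i k where x: "x = (i, k)" "0 \<le> i" "i < int d2" "0 \<le> k" "k < int d1" by auto
        define e2 :: rat where "e2 = of_int i / of_nat d2"
        have fl2: "of_nat d2 * e2 = of_int i" using d2(1) by (simp add: e2_def)
        then obtain c0 c1 where c: "is_integral c0 c1 e2" using d2(2)[of e2] by auto
        \<comment> \<open>The fractional part of \<open>d1 * c1\<close> is forced by
          \<open>e2\<close>; only its floor can be moved, here to \<open>k\<close>.\<close>
        define l :: rat where "l = of_int (k - \<lfloor>of_nat d1 * c1\<rfloor>) / of_nat d1"
        have fl1: "of_nat d1 * l = of_int (k - \<lfloor>of_nat d1 * c1\<rfloor>)" using d1(1) by (simp add: l_def)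
        then obtain c0' where c': "is_integral c0' l 0" using d1(2)[of l] by (metis Ints_of_int)
        have "is_integral (c0 + c0') (c1 + l) e2" using is_integral_add[OF c c'] by simp
        from is_integral_diff[OF this is_integral_ints[of "of_int \<lfloor>c0 + c0'\<rfloor>" 0 0]]
        have i: "is_integral (frac (c0 + c0')) (c1 + l) e2" by (simp add: frac_def)
        have e1: "of_nat d1 * (c1 + l) = frac (of_nat d1 * c1) + of_int k"
          by (simp add: distrib_left fl1 frac_def)
        have fle1: "\<lfloor>of_nat d1 * (c1 + l)\<rfloor> = k" unfolding e1 by simp
        have kd: "of_int k + 1 \<le> (of_nat d1 :: rat)"
        proof -
          have "of_int (k + 1) \<le> (of_int (int d1) :: rat)" using x by (simp only: of_int_le_iff)
          then show ?thesis by simp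
        qed
        have "0 \<le> of_nat d1 * (c1 + l)" "of_nat d1 * (c1 + l) < of_nat d1 * 1"
          using frac_ge_0[of "of_nat d1 * c1"] frac_lt_1[of "of_nat d1 * c1"] x kd unfolding e1
          by (auto intro: add_nonneg_nonneg)
        then have "0 \<le> c1 + l" "c1 + l < 1" using d1(1)
          by (auto simp: zero_le_mult_iff mult_less_cancel_left simp del: distrib_left)
        moreover have "0 \<le> e2" "e2 < 1"
        proof -
          have "(of_int i :: rat) < of_int (int d2)" using x by (simp only: of_int_less_iff)
          then show "0 \<le> e2" "e2 < 1" using x by (auto simp: e2_def divide_less_eq)
        qed
        ultimately have "(frac (c0 + c0'), c1 + l, e2) \<in> E"
          using i by (simp add: E_def frac_lt_1)
        moreover have "(\<lambda>(c0, c1, c2). (\<lfloor>of_nat d2 * c2\<rfloor>, \<lfloor>of_nat d1 * c1\<rfloor>)) (frac (c0 + c0'), c1 + l, e2) = x"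
          using x fle1 fl2 by simp
        ultimately show "x \<in> (\<lambda>(c0, c1, c2). (\<lfloor>of_nat d2 * c2\<rfloor>, \<lfloor>of_nat d1 * c1\<rfloor>)) ` E"
          by (metis (mono_tags) image_eqI)
      qed
    qed
  qed
  finally show ?thesis by simp
qed

end

subsection \<open>Divisibility form of the index\<close>

lemma algebraic_int_monic_cubic:
  fixes x :: complex
  assumes "x ^ 3 + of_int a * x ^ 2 + of_int b * x + of_int c = 0"
  shows "algebraic_int x"
  unfolding algebraic_int_altdef_ipoly
  by (rule exI[of _ "[:c, b, a, 1:]"])
    (use assms in \<open>simp add: hom_distribs algebra_simps power2_eq_square power3_eq_cube\<close>)

lemma of_int_divide_Ints_iff:
  assumes "(k::int) \<noteq> 0"
  shows "of_int m / of_int k \<in> (\<int> :: rat set) \<longleftrightarrow> k dvd m"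
proof
  assume "of_int m / of_int k \<in> (\<int> :: rat set)"
  then obtain q where "of_int m / of_int k = (of_int q :: rat)" by (auto elim: Ints_cases)
  then have "of_int m = (of_int (q * k) :: rat)" using assms by (simp add: field_simps)
  then show "k dvd m" by (simp only: of_int_eq_iff) simp
qed (use assms in auto)

lemma of_rat_of_int_divide: "of_rat (of_int m / of_int k) = (of_int m / of_int k :: complex)"
  by (simp add: of_rat_divide)

context cubic_roots
begin

text \<open>The coefficients are those of \<open>f(r + d Y) / d^3\<close>, that is, the Taylor
  coefficients of \<open>f\<close> at \<open>r\<close> divided by powers of
  \<open>d\<close>.\<close>

lemma shifted_root_eq:
  assumes z: "z \<in> {z1, z2, z3}" and "d \<noteq> 0"
    and a: "3 * r + t = d * a" and b: "3 * r\<^sup>2 + 2 * t * r + A = d\<^sup>2 * b"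
    and c: "r ^ 3 + t * r\<^sup>2 + A * r + B = d ^ 3 * c"
    and y: "z = of_int r + of_int d * y"
  shows "y ^ 3 + of_int a * y\<^sup>2 + of_int b * y + of_int c = 0"
proof -
  have "of_int (3 * r + t) = (of_int (d * a) :: complex)"
    "of_int (3 * r\<^sup>2 + 2 * t * r + A) = (of_int (d\<^sup>2 * b) :: complex)"
    "of_int (r ^ 3 + t * r\<^sup>2 + A * r + B) = (of_int (d ^ 3 * c) :: complex)"
    using a b c by simp_all
  then have e: "of_int d * of_int a = (3 * of_int r + of_int t :: complex)"
    "of_int d ^ 2 * of_int b = (3 * of_int r ^ 2 + 2 * of_int t * of_int r + of_int A :: complex)"
    "of_int d ^ 3 * of_int c = (of_int r ^ 3 + of_int t * of_int r ^ 2 + of_int A * of_int r + of_int B :: complex)"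
    by simp_all
  have "of_int d ^ 3 * (y ^ 3 + of_int a * y\<^sup>2 + of_int b * y + of_int c)
    = of_int d ^ 3 * y ^ 3 + (of_int d * of_int a) * (of_int d ^ 2 * y ^ 2)
      + (of_int d ^ 2 * of_int b) * (of_int d * y) + of_int d ^ 3 * of_int c"
    by (simp add: algebra_simps power2_eq_square power3_eq_cube)
  also have "\<dots> = z ^ 3 + of_int t * z ^ 2 + of_int A * z + of_int B"
    unfolding e y by (simp add: algebra_simps power2_eq_square power3_eq_cube)
  also have "\<dots> = 0" by (rule root_eq[OF z])
  finally show ?thesis using \<open>d \<noteq> 0\<close> by simp
qed

lemma is_integral_shift:
  fixes r d :: int
  assumes d: "d \<noteq> 0"
    and alg: "\<And>z y. z \<in> {z1, z2, z3} \<Longrightarrow> z = of_int r + of_int d * y \<Longrightarrow>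
      algebraic_int (of_rat e0 + of_rat e1 * y + of_rat e2 * y\<^sup>2)"
  shows "is_integral (e0 - e1 * of_int r / of_int d + e2 * of_int r ^ 2 / of_int d ^ 2)
    (e1 / of_int d - 2 * e2 * of_int r / of_int d ^ 2) (e2 / of_int d ^ 2)"
  unfolding is_integral_def
proof
  fix z assume z: "z \<in> {z1, z2, z3}"
  define y where "y = (z - of_int r) / of_int d"
  have y: "z = of_int r + of_int d * y" using d by (simp add: y_def)
  have "of_rat (e0 - e1 * of_int r / of_int d + e2 * of_int r ^ 2 / of_int d ^ 2)
      + of_rat (e1 / of_int d - 2 * e2 * of_int r / of_int d ^ 2) * z + of_rat (e2 / of_int d ^ 2) * z ^ 2
    = of_rat e0 + of_rat e1 * y + of_rat e2 * y ^ 2"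
    using d unfolding y by (simp add: of_rat_diff of_rat_add of_rat_mult of_rat_divide of_rat_power
        field_simps power2_eq_square)
  then show "algebraic_int (of_rat (e0 - e1 * of_int r / of_int d + e2 * of_int r ^ 2 / of_int d ^ 2)
      + of_rat (e1 / of_int d - 2 * e2 * of_int r / of_int d ^ 2) * z + of_rat (e2 / of_int d ^ 2) * z ^ 2)"
    using alg[OF z y] by simp
qed

text \<open>Two integral elements witness the denominators: \<open>y = (x - r) / D\<close> and
  \<open>w = (y^2 + a y + J \<beta>) / J\<close>, where \<open>y w = - J \<gamma>\<close>. Up to
  signs, the products of \<open>y\<close> and \<open>w\<close> are the Delone-Faddeev multiplication
  table of the binary cubic form with coefficients \<open>J, a, \<beta>, \<gamma>\<close>, so
  \<open>1, y, w\<close> span a ring; eliminating \<open>y\<close> gives a monic cubic for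
  \<open>w\<close>.\<close>

lemma denominators_if_dvd:
  fixes D J r :: int
  assumes d1: "\<And>c. (\<exists>c0. is_integral c0 c 0) \<longleftrightarrow> of_nat d1 * c \<in> \<int>"
    and d2: "\<And>c. (\<exists>c0 c1. is_integral c0 c1 c) \<longleftrightarrow> of_nat d2 * c \<in> \<int>"
    and D: "D > 0" and J: "J > 0"
    and dvd: "D dvd 3 * r + t" "D\<^sup>2 * J dvd 3 * r\<^sup>2 + 2 * t * r + A"
      "D ^ 3 * J\<^sup>2 dvd r ^ 3 + t * r\<^sup>2 + A * r + B"
  shows "D dvd int d1" "D\<^sup>2 * J dvd int d2"
proof -
  obtain a \<beta> \<gamma> where e: "3 * r + t = D * a" "3 * r\<^sup>2 + 2 * t * r + A = D\<^sup>2 * J * \<beta>"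
    "r ^ 3 + t * r\<^sup>2 + A * r + B = D ^ 3 * J\<^sup>2 * \<gamma>"
    using dvd by (metis dvdE)
  have y: "y ^ 3 + of_int a * y\<^sup>2 + of_int (J * \<beta>) * y + of_int (J\<^sup>2 * \<gamma>) = 0"
    if "z \<in> {z1, z2, z3}" "z = of_int r + of_int D * y" for z y
    by (rule shifted_root_eq[OF that(1) _ _ _ _ that(2)]) (use D e in \<open>auto simp: mult_ac\<close>)
  have "is_integral (0 - 1 * of_int r / of_int D + 0 * of_int r ^ 2 / of_int D ^ 2)
    (1 / of_int D - 2 * 0 * of_int r / of_int D ^ 2) (0 / of_int D ^ 2)"
  proof (rule is_integral_shift)
    fix z y assume "z \<in> {z1, z2, z3}" "z = of_int r + of_int D * y"
    from algebraic_int_monic_cubic[OF y[OF this]]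
    show "algebraic_int (of_rat 0 + of_rat 1 * y + of_rat 0 * y\<^sup>2)" by simp
  qed (use D in auto)
  then have "of_nat d1 * (1 / of_int D) \<in> (\<int> :: rat set)" using d1[of "1 / of_int D"] by auto
  then show "D dvd int d1" using of_int_divide_Ints_iff[of D "int d1"] D by simp
  have J': "of_int J \<noteq> (0::complex)" using J by simp
  have "is_integral (of_int \<beta> - (of_int a / of_int J) * of_int r / of_int D + (1 / of_int J) * of_int r ^ 2 / of_int D ^ 2)
    ((of_int a / of_int J) / of_int D - 2 * (1 / of_int J) * of_int r / of_int D ^ 2) ((1 / of_int J) / of_int D ^ 2)"
  proof (rule is_integral_shift)
    fix z y assume "z \<in> {z1, z2, z3}" "z = of_int r + of_int D * y"
    note y = y[OF this]
    define w where "w = of_int \<beta> + of_int a / of_int J * y + 1 / of_int J * y\<^sup>2"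
    have Jw: "of_int J * w = y\<^sup>2 + of_int a * y + of_int J * of_int \<beta>"
      using J' by (simp add: w_def field_simps)
    have "of_int J * (y * w + of_int J * of_int \<gamma>) = y * (of_int J * w) + of_int J * of_int J * of_int \<gamma>"
      by (simp add: algebra_simps)
    also have "\<dots> = y ^ 3 + of_int a * y\<^sup>2 + of_int (J * \<beta>) * y + of_int (J\<^sup>2 * \<gamma>)"
      unfolding Jw by (simp add: algebra_simps power2_eq_square power3_eq_cube)
    finally have yw: "y * w = - of_int J * of_int \<gamma>"
      using y J' by (simp add: add_eq_0_iff2)
    have "of_int J * w\<^sup>2 = w * (of_int J * w)" by (simp add: power2_eq_square)
    also have "\<dots> = y * (y * w) + of_int a * (y * w) + of_int J * of_int \<beta> * w"
      unfolding Jw by (simp add: algebra_simps power2_eq_square)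
    also have "\<dots> = of_int J * (- of_int \<gamma> * y - of_int a * of_int \<gamma> + of_int \<beta> * w)"
      unfolding yw by (simp add: algebra_simps)
    finally have w2: "w\<^sup>2 = - of_int \<gamma> * y - of_int a * of_int \<gamma> + of_int \<beta> * w"
      using J' by simp
    have "w ^ 3 = w * w\<^sup>2" by (simp add: power2_eq_square power3_eq_cube)
    also have "\<dots> = w * (- of_int \<gamma> * y - of_int a * of_int \<gamma> + of_int \<beta> * w)"
      by (simp only: w2)
    also have "\<dots> = - of_int \<gamma> * (y * w) - of_int a * of_int \<gamma> * w + of_int \<beta> * w\<^sup>2"
      by (simp add: algebra_simps power2_eq_square)
    finally have "w ^ 3 + of_int (- \<beta>) * w\<^sup>2 + of_int (a * \<gamma>) * w + of_int (- (J * \<gamma>\<^sup>2)) = 0"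
      unfolding yw by (simp add: algebra_simps power2_eq_square)
    from algebraic_int_monic_cubic[OF this]
    show "algebraic_int (of_rat (of_int \<beta>) + of_rat (of_int a / of_int J) * y + of_rat (1 / of_int J) * y\<^sup>2)"
      by (simp add: w_def of_rat_divide)
  qed (use D in auto)
  then have "of_nat d2 * (1 / of_int J / of_int D ^ 2) \<in> (\<int> :: rat set)"
    using d2[of "1 / of_int J / of_int D ^ 2"] by auto
  then have "of_int (int d2) / of_int (D\<^sup>2 * J) \<in> (\<int> :: rat set)" by (simp add: mult.commute)
  then show "D\<^sup>2 * J dvd int d2" using of_int_divide_Ints_iff[of "D\<^sup>2 * J" "int d2"] D J by simp
qed

lemma dvd_ind:
  fixes D J r :: int
  assumes "D > 0" "J > 0" "D dvd 3 * r + t" "D\<^sup>2 * J dvd 3 * r\<^sup>2 + 2 * t * r + A"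
      "D ^ 3 * J\<^sup>2 dvd r ^ 3 + t * r\<^sup>2 + A * r + B"
  shows "D ^ 3 * J dvd int (ind (cubic (t, A, B)))"
proof -
  obtain d1 where d1: "d1 > 0" "\<And>c. (\<exists>c0. is_integral c0 c 0) \<longleftrightarrow> of_nat d1 * c \<in> \<int>"
    using is_integral_denominators(1) by blast
  obtain d2 where d2: "d2 > 0" "\<And>c. (\<exists>c0 c1. is_integral c0 c1 c) \<longleftrightarrow> of_nat d2 * c \<in> \<int>"
    using is_integral_denominators(2) by blast
  have "D * (D\<^sup>2 * J) dvd int d1 * int d2"
    using denominators_if_dvd[OF d1(2) d2(2) assms] by (intro mult_dvd_mono)
  then show ?thesis by (simp add: ind_eq[OF d1 d2] power2_eq_square power3_eq_cube mult.assoc)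
qed

end

section \<open>A normalised basis of the maximal order\<close>

context cubic_roots
begin

text \<open>Here \<open>y\<close> is the coordinate \<open>(x - r)/d\<close>, with minimal equation \<open>y\<^sup>3 + a y\<^sup>2 + b y + c = 0\<close>.  The shift
  \<open>r\<close> is normalised so that \<open>w\<close> below has the same linear coefficient as \<open>y\<^sup>2 + a y + b = - c/y\<close>; then
  integrality of \<open>y w\<close> replaces \<open>v\<close> by \<open>b\<close>, and \<open>w\<^sup>2 = (b/j) w - (c/j\<^sup>2) y - a c/j\<^sup>2\<close> yields \<open>j | b\<close> and
  \<open>j\<^sup>2 | c\<close>.\<close>

lemma index_core:
  fixes r d j a v :: int
  assumes d: "d > 0" and j: "j > 0"
    and F1: "\<And>e0 e1. (\<And>z y. z \<in> {z1, z2, z3} \<Longrightarrow> z = of_int r + of_int d * y \<Longrightarrow>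
      algebraic_int (of_rat e0 + of_rat e1 * y)) \<Longrightarrow> e1 \<in> \<int>"
    and F2: "\<And>e0 e1 e2. (\<And>z y. z \<in> {z1, z2, z3} \<Longrightarrow> z = of_int r + of_int d * y \<Longrightarrow>
      algebraic_int (of_rat e0 + of_rat e1 * y + of_rat e2 * y\<^sup>2)) \<Longrightarrow> of_int j * e2 \<in> \<int>"
    and a: "3 * r + t = d * a"
    and y: "\<And>z y. z \<in> {z1, z2, z3} \<Longrightarrow> z = of_int r + of_int d * y \<Longrightarrow> algebraic_int y"
    and w: "\<And>z y. z \<in> {z1, z2, z3} \<Longrightarrow> z = of_int r + of_int d * y \<Longrightarrow>
      algebraic_int ((y\<^sup>2 + of_int a * y + of_int v) / of_int j)"
  shows "d\<^sup>2 * j dvd 3 * r\<^sup>2 + 2 * t * r + A" "d ^ 3 * j\<^sup>2 dvd r ^ 3 + t * r\<^sup>2 + A * r + B"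
proof -
  define y1 y2 y3 where "y1 = (z1 - of_int r) / of_int d" and "y2 = (z2 - of_int r) / of_int d"
    and "y3 = (z3 - of_int r) / of_int d"
  have z: "z1 = of_int r + of_int d * y1" "z2 = of_int r + of_int d * y2" "z3 = of_int r + of_int d * y3"
    using d by (simp_all add: y1_def y2_def y3_def)
  have alg: "algebraic_int y1" "algebraic_int y2" "algebraic_int y3"
    by (rule y[of z1], simp, rule z, rule y[of z2], simp, rule z, rule y[of z3], simp, rule z)
  \<comment> \<open>Elementary symmetric functions of the shifted roots are rational and algebraic
    integers. This gives the divisibility by \<open>d^2\<close> here and by \<open>d^3\<close>
    below; the factors involving \<open>j\<close> come later.\<close>
  have "of_rat (of_int (3 * r\<^sup>2 + 2 * t * r + A) / of_int (d\<^sup>2)) = y1 * y2 + y1 * y3 + y2 * y3"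
    unfolding of_rat_of_int_divide using d by (simp add: vieta z field_simps power2_eq_square)
  also have "algebraic_int \<dots>" by (intro algebraic_int_add_mult alg)
  finally have "d\<^sup>2 dvd 3 * r\<^sup>2 + 2 * t * r + A"
    using d unfolding algebraic_int_of_rat_iff by (subst (asm) of_int_divide_Ints_iff) auto
  then obtain b where b: "3 * r\<^sup>2 + 2 * t * r + A = d\<^sup>2 * b" by (auto elim: dvdE)
  have "of_rat (of_int (r ^ 3 + t * r\<^sup>2 + A * r + B) / of_int (d ^ 3)) = - (y1 * y2 * y3)"
    unfolding of_rat_of_int_divide using d by (simp add: vieta z field_simps power2_eq_square power3_eq_cube)
  also have "algebraic_int \<dots>" by (simp add: algebraic_int_add_mult alg)
  finally have "d ^ 3 dvd r ^ 3 + t * r\<^sup>2 + A * r + B"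
    using d unfolding algebraic_int_of_rat_iff by (subst (asm) of_int_divide_Ints_iff) auto
  then obtain c where c: "r ^ 3 + t * r\<^sup>2 + A * r + B = d ^ 3 * c" by (auto elim: dvdE)
  have eq: "y * (y\<^sup>2 + of_int a * y + of_int b) = - of_int c"
    if "z \<in> {z1, z2, z3}" "z = of_int r + of_int d * y" for z y
  proof -
    have "y * (y\<^sup>2 + of_int a * y + of_int b) + of_int c = y ^ 3 + of_int a * y\<^sup>2 + of_int b * y + of_int c"
      by (simp add: algebra_simps power2_eq_square power3_eq_cube)
    also have "\<dots> = 0" using shifted_root_eq[OF that(1) _ a b c that(2)] d by simp
    finally show ?thesis by (simp only: eq_neg_iff_add_eq_0)
  qed
  have j': "of_int j \<noteq> (0::complex)" using j by simp
  have "of_int (v - b) / of_int j \<in> (\<int> :: rat set)"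
  proof (rule F1[of "- of_int c / of_int j"])
    fix z y' assume zy: "z \<in> {z1, z2, z3}" "z = of_int r + of_int d * y'"
    have "y' * ((y'\<^sup>2 + of_int a * y' + of_int v) / of_int j)
      = (y' * (y'\<^sup>2 + of_int a * y' + of_int b) + of_int (v - b) * y') / of_int j"
      by (simp add: algebra_simps)
    also have "\<dots> = of_rat (- of_int c / of_int j) + of_rat (of_int (v - b) / of_int j) * y'"
      unfolding eq[OF zy] using j' by (simp add: of_rat_divide of_rat_minus of_rat_diff field_simps)
    finally show "algebraic_int (of_rat (- of_int c / of_int j) + of_rat (of_int (v - b) / of_int j) * y')"
      using algebraic_int_add_mult(2)[OF y[OF zy] w[OF zy]] by simp
  qed
  then obtain m where m: "v - b = j * m" using j of_int_divide_Ints_iff[of j "v - b"] by (auto elim: dvdE)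
  have w': "algebraic_int ((y\<^sup>2 + of_int a * y + of_int b) / of_int j)"
    if zy: "z \<in> {z1, z2, z3}" "z = of_int r + of_int d * y" for z y
  proof -
    have "of_int v = of_int b + of_int j * (of_int m :: complex)"
      by (metis m add_diff_cancel_left' diff_add_cancel of_int_add of_int_mult add.commute)
    then have "(y\<^sup>2 + of_int a * y + of_int b) / of_int j
        = (y\<^sup>2 + of_int a * y + of_int v) / of_int j - of_int m"
      using j' by (simp add: field_simps)
    then show ?thesis using algebraic_int_diff[OF w[OF zy] algebraic_int_of_int[of m]] by simp
  qed
  have sq: "((y\<^sup>2 + of_int a * y + of_int b) / of_int j)\<^sup>2
      = (- of_int c * y - of_int a * of_int c + of_int b * (y\<^sup>2 + of_int a * y + of_int b)) / of_int j ^ 2"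
    if zy: "z \<in> {z1, z2, z3}" "z = of_int r + of_int d * y" for z y
  proof -
    define Q where "Q = y\<^sup>2 + of_int a * y + of_int b"
    have yQ: "y * Q = - of_int c" using eq[OF zy] by (simp add: Q_def)
    have "Q\<^sup>2 = y * (y * Q) + of_int a * (y * Q) + of_int b * Q"
      by (simp add: Q_def algebra_simps power2_eq_square)
    also have "\<dots> = - of_int c * y - of_int a * of_int c + of_int b * Q"
      unfolding yQ by simp
    finally show ?thesis unfolding Q_def by (simp add: power_divide)
  qed
  have "of_int j * (of_int b / of_int j ^ 2) \<in> (\<int> :: rat set)"
  proof (rule F2[of "(of_int b ^ 2 - of_int a * of_int c) / of_int j ^ 2"
        "(of_int a * of_int b - of_int c) / of_int j ^ 2"])
    fix z y' assume zy: "z \<in> {z1, z2, z3}" "z = of_int r + of_int d * y'"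
    have "of_rat ((of_int b ^ 2 - of_int a * of_int c) / of_int j ^ 2)
        + of_rat ((of_int a * of_int b - of_int c) / of_int j ^ 2) * y' + of_rat (of_int b / of_int j ^ 2) * y'\<^sup>2
      = ((y'\<^sup>2 + of_int a * y' + of_int b) / of_int j)\<^sup>2"
      unfolding sq[OF zy] using j'
      by (simp add: of_rat_divide of_rat_diff of_rat_mult of_rat_power field_simps power2_eq_square)
    then show "algebraic_int (of_rat ((of_int b ^ 2 - of_int a * of_int c) / of_int j ^ 2)
        + of_rat ((of_int a * of_int b - of_int c) / of_int j ^ 2) * y' + of_rat (of_int b / of_int j ^ 2) * y'\<^sup>2)"
      using algebraic_int_power[OF w'[OF zy], of 2] by simp
  qed
  then have "of_int b / of_int j \<in> (\<int> :: rat set)" using j by (simp add: power2_eq_square)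
  then obtain \<beta> where \<beta>: "b = j * \<beta>" using j of_int_divide_Ints_iff[of j b] by (auto elim: dvdE)
  have "- of_int c / of_int (j\<^sup>2) \<in> (\<int> :: rat set)"
  proof (rule F1[of "- (of_int a * of_int c) / of_int (j\<^sup>2)"])
    fix z y' assume zy: "z \<in> {z1, z2, z3}" "z = of_int r + of_int d * y'"
    have "of_rat (- (of_int a * of_int c) / of_int (j\<^sup>2)) + of_rat (- of_int c / of_int (j\<^sup>2)) * y'
      = ((y'\<^sup>2 + of_int a * y' + of_int b) / of_int j)\<^sup>2
        - of_int \<beta> * ((y'\<^sup>2 + of_int a * y' + of_int b) / of_int j)"
      unfolding sq[OF zy] unfolding \<beta> using j'
      by (simp add: of_rat_divide of_rat_minus of_rat_mult of_rat_power field_simps power2_eq_square)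
    then show "algebraic_int (of_rat (- (of_int a * of_int c) / of_int (j\<^sup>2)) + of_rat (- of_int c / of_int (j\<^sup>2)) * y')"
      using algebraic_int_diff[OF algebraic_int_power[OF w'[OF zy], of 2]
          algebraic_int_add_mult(2)[OF algebraic_int_of_int[of \<beta>] w'[OF zy]]] by simp
  qed
  then have "j\<^sup>2 dvd c" using j of_int_divide_Ints_iff[of "j\<^sup>2" "- c"] by simp
  then show "d ^ 3 * j\<^sup>2 dvd r ^ 3 + t * r\<^sup>2 + A * r + B" unfolding c by simp
  show "d\<^sup>2 * j dvd 3 * r\<^sup>2 + 2 * t * r + A" unfolding b \<beta> by simp
qed

text \<open>Take \<open>d = d1\<close> and \<open>j = d2 / d^2\<close>. The division is exact
  because the square of the integral element \<open>y = (x - r0) / d\<close> has leading coefficient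
  \<open>1 / d^2\<close>. \<open>F1\<close> and \<open>F2\<close> restate the definitions of
  \<open>d1\<close> and \<open>d2\<close> in the coordinate \<open>y\<close>. The final clause, that
  every content \<open>D\<close> at any point divides \<open>d\<close>, excludes larger contents
  when deep roots are constructed.\<close>

lemma index_structure:
  "\<exists>d j r. d > 0 \<and> j > 0 \<and> int (ind (cubic (t, A, B))) = d ^ 3 * j \<and> d dvd 3 * r + t \<and>
    d\<^sup>2 * j dvd 3 * r\<^sup>2 + 2 * t * r + A \<and> d ^ 3 * j\<^sup>2 dvd r ^ 3 + t * r\<^sup>2 + A * r + B \<and>
    (\<forall>D r. D > 0 \<longrightarrow> D dvd 3 * r + t \<longrightarrow> D\<^sup>2 dvd 3 * r\<^sup>2 + 2 * t * r + A \<longrightarrow>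
      D ^ 3 dvd r ^ 3 + t * r\<^sup>2 + A * r + B \<longrightarrow> D dvd d)"
proof -
  obtain d1 where d1: "d1 > 0" "\<And>c. (\<exists>c0. is_integral c0 c 0) \<longleftrightarrow> of_nat d1 * c \<in> \<int>"
    using is_integral_denominators(1) by blast
  obtain d2 where d2: "d2 > 0" "\<And>c. (\<exists>c0 c1. is_integral c0 c1 c) \<longleftrightarrow> of_nat d2 * c \<in> \<int>"
    using is_integral_denominators(2) by blast
  define d where "d = int d1"
  have d: "d > 0" using d1(1) by (simp add: d_def)
  have dq: "of_nat d1 = (of_int d :: rat)" by (simp add: d_def)
  have d0: "of_int d \<noteq> (0 :: complex)" "of_int d \<noteq> (0 :: rat)" using d by simp_all
  have F1: "e1 \<in> \<int>" if "\<And>z y. z \<in> {z1, z2, z3} \<Longrightarrow> z = of_int r + of_int d * y \<Longrightarrow>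
      algebraic_int (of_rat e0 + of_rat e1 * y)" for e0 e1 r
  proof -
    have "is_integral (e0 - e1 * of_int r / of_int d + 0 * of_int r ^ 2 / of_int d ^ 2)
      (e1 / of_int d - 2 * 0 * of_int r / of_int d ^ 2) (0 / of_int d ^ 2)"
      by (rule is_integral_shift) (use d that in auto)
    then have "of_nat d1 * (e1 / of_int d) \<in> \<int>" using d1(2)[of "e1 / of_int d"] by auto
    then show ?thesis using d0 by (simp add: dq)
  qed
  obtain c0 where c0: "is_integral c0 (1 / of_int d) 0"
    using d1(2)[of "1 / of_int d"] d0 by (auto simp: dq)
  \<comment> \<open>\<open>d\<close> times the integral element \<open>c0 + x / d\<close>, minus
    \<open>x\<close>, is the constant \<open>d * c0\<close>; so that constant is an integer, called
    \<open>- r0\<close>.\<close>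
  have "of_rat (of_int d * c0) = of_int d * (of_rat c0 + of_rat (1 / of_int d) * z1 + of_rat 0 * z1\<^sup>2) - z1"
    using d0 by (simp add: of_rat_mult of_rat_divide field_simps)
  also have "algebraic_int \<dots>"
    by (intro algebraic_int_diff algebraic_int_add_mult(2) algebraic_int_of_int algebraic_int_root_poly[of z1])
      (use c0 in \<open>simp_all add: is_integral_def\<close>)
  finally have "of_int d * c0 \<in> \<int>" by (simp only: algebraic_int_of_rat_iff)
  then obtain r0 where "of_int d * c0 = of_int (- r0)" by (metis Ints_cases minus_minus)
  then have r0: "c0 = - (of_int r0) / of_int d" using d0 by (simp add: field_simps)
  have y0: "algebraic_int y" if "z \<in> {z1, z2, z3}" "z = of_int r0 + of_int d * y" for z y
  proof -
    have "y = of_rat c0 + of_rat (1 / of_int d) * z + of_rat 0 * z\<^sup>2"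
      using d0 that(2) by (simp add: r0 of_rat_divide of_rat_minus field_simps)
    then show ?thesis using c0 that(1) unfolding is_integral_def by metis
  qed
  have "is_integral (0 - 0 * of_int r0 / of_int d + 1 * of_int r0 ^ 2 / of_int d ^ 2)
      (0 / of_int d - 2 * 1 * of_int r0 / of_int d ^ 2) (1 / of_int d ^ 2)"
    by (rule is_integral_shift) (use d y0 in \<open>auto intro: algebraic_int_power simp del: of_int_power\<close>)
  then have "of_nat d2 * (1 / of_int d ^ 2) \<in> (\<int> :: rat set)"
    using d2(2)[of "1 / of_int d ^ 2"] by blast
  then have "d\<^sup>2 dvd int d2" using of_int_divide_Ints_iff[of "d\<^sup>2" "int d2"] d by simp
  then obtain j where j: "int d2 = d\<^sup>2 * j" by (auto elim: dvdE)
  have "d\<^sup>2 * j > 0" using d2(1) by (simp flip: j)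
  then have j0: "j > 0" using d by (simp add: zero_less_mult_iff)
  then have j': "of_int j \<noteq> (0 :: complex)" "of_int j \<noteq> (0 :: rat)" by simp_all
  have d2q: "of_nat d2 = (of_int d ^ 2 * of_int j :: rat)"
    by (metis j of_int_mult of_int_of_nat_eq of_int_power)
  have F2: "of_int j * e2 \<in> \<int>" if "\<And>z y. z \<in> {z1, z2, z3} \<Longrightarrow> z = of_int r + of_int d * y \<Longrightarrow>
      algebraic_int (of_rat e0 + of_rat e1 * y + of_rat e2 * y\<^sup>2)" for e0 e1 e2 r
  proof -
    have "is_integral (e0 - e1 * of_int r / of_int d + e2 * of_int r ^ 2 / of_int d ^ 2)
      (e1 / of_int d - 2 * e2 * of_int r / of_int d ^ 2) (e2 / of_int d ^ 2)"
      by (rule is_integral_shift) (use d that in auto)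
    then have "of_nat d2 * (e2 / of_int d ^ 2) \<in> \<int>" using d2(2)[of "e2 / of_int d ^ 2"] by blast
    then show ?thesis using d0 by (simp add: d2q)
  qed
  obtain u0 u1 where u: "is_integral u0 u1 (1 / (of_int d ^ 2 * of_int j))"
    using d2(2)[of "1 / (of_int d ^ 2 * of_int j)"] d0 j' by (auto simp: d2q)
  define U where "U = u1 * of_int d * of_int j + 2 * of_int r0 / of_int d"
  define V where "V = of_int j * (u0 + u1 * of_int r0) + of_int r0 ^ 2 / of_int d ^ 2"
  have w0: "algebraic_int ((y\<^sup>2 + of_rat U * y + of_rat V) / of_int j)"
    if "z \<in> {z1, z2, z3}" "z = of_int r0 + of_int d * y" for z y
  proof -
    have "(y\<^sup>2 + of_rat U * y + of_rat V) / of_int j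
        = of_rat u0 + of_rat u1 * z + of_rat (1 / (of_int d ^ 2 * of_int j)) * z\<^sup>2"
      using d0 j' unfolding that(2) U_def V_def
      by (simp add: of_rat_divide of_rat_add of_rat_mult of_rat_power field_simps power2_eq_square)
    then show ?thesis using u that(1) unfolding is_integral_def by metis
  qed
  \<comment> \<open>Removing \<open>y^2\<close> from \<open>j\<close> times the quadratic generator
    leaves an integral linear element, so \<open>U\<close> is an integer by \<open>F1\<close>, and
    then so is \<open>V\<close>.\<close>
  have w1: "algebraic_int (of_rat V + of_rat U * y)"
    if zy: "z \<in> {z1, z2, z3}" "z = of_int r0 + of_int d * y" for z y
  proof -
    have "of_rat V + of_rat U * y = of_int j * ((y\<^sup>2 + of_rat U * y + of_rat V) / of_int j) - y\<^sup>2"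
      using j' by simp
    also have "algebraic_int \<dots>"
      by (intro algebraic_int_diff algebraic_int_add_mult(2) algebraic_int_of_int algebraic_int_power w0[OF zy] y0[OF zy])
    finally show ?thesis .
  qed
  have "U \<in> \<int>" by (rule F1[OF w1])
  then obtain u where uU: "U = of_int u" by (auto elim: Ints_cases)
  define y1 y2 y3 where "y1 = (z1 - of_int r0) / of_int d" and "y2 = (z2 - of_int r0) / of_int d"
    and "y3 = (z3 - of_int r0) / of_int d"
  have z: "z1 = of_int r0 + of_int d * y1" "z2 = of_int r0 + of_int d * y2" "z3 = of_int r0 + of_int d * y3"
    using d0 by (simp_all add: y1_def y2_def y3_def)
  have alg: "algebraic_int y1" "algebraic_int y2" "algebraic_int y3"
    by (rule y0[of z1], simp, rule z, rule y0[of z2], simp, rule z, rule y0[of z3], simp, rule z)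
  have "of_rat V = (of_rat V + of_rat U * y1) - of_int u * y1" by (simp add: uU)
  also have "algebraic_int \<dots>"
    by (intro algebraic_int_diff algebraic_int_add_mult(2) algebraic_int_of_int alg w1[OF _ z(1)]) simp
  finally obtain v where vV: "V = of_int v" unfolding algebraic_int_of_rat_iff by (auto elim: Ints_cases)
  have "of_rat (of_int (3 * r0 + t) / of_int d) = - (y1 + y2 + y3)"
    unfolding of_rat_of_int_divide using d0 by (simp add: vieta z field_simps)
  also have "algebraic_int \<dots>" unfolding algebraic_int_minus_iff by (intro algebraic_int_add_mult alg)
  finally have "d dvd 3 * r0 + t"
    using d unfolding algebraic_int_of_rat_iff by (subst (asm) of_int_divide_Ints_iff) auto
  then obtain a0 where a0: "3 * r0 + t = d * a0" by (auto elim: dvdE)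
  \<comment> \<open>After replacing \<open>r0\<close> by \<open>r0 + d * s\<close>, the linear
    coefficient in the generator is \<open>u + 2 * s\<close>, while the cubic for \<open>y\<close>
    has quadratic coefficient \<open>a0 + 3 * s\<close>. They agree exactly for this
    \<open>s\<close>, which is the normalisation required by \<open>index_core\<close>.\<close>
  define s where "s = u - a0"
  define r where "r = r0 + d * s"
  have sh: "z = of_int r0 + of_int d * (y + of_int s)" if "z = of_int r + of_int d * y" for z y :: complex
    using that by (simp add: r_def algebra_simps)
  have a: "3 * r + t = d * (a0 + 3 * s)" using a0 by (simp add: r_def algebra_simps)
  have "d\<^sup>2 * j dvd 3 * r\<^sup>2 + 2 * t * r + A \<and> d ^ 3 * j\<^sup>2 dvd r ^ 3 + t * r\<^sup>2 + A * r + B"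
  proof -
    have yr: "algebraic_int y" if zy: "z \<in> {z1, z2, z3}" "z = of_int r + of_int d * y" for z y
    proof -
      have "algebraic_int ((y + of_int s) - of_int s)"
        by (intro algebraic_int_diff algebraic_int_of_int y0[OF zy(1) sh[OF zy(2)]])
      then show ?thesis by simp
    qed
    have wr: "algebraic_int ((y\<^sup>2 + of_int (a0 + 3 * s) * y + of_int (s\<^sup>2 + u * s + v)) / of_int j)"
      if zy: "z \<in> {z1, z2, z3}" "z = of_int r + of_int d * y" for z y
    proof -
      have "u = s + a0" by (simp add: s_def)
      then have "((y + of_int s)\<^sup>2 + of_rat U * (y + of_int s) + of_rat V) / of_int j
        = (y\<^sup>2 + of_int (a0 + 3 * s) * y + of_int (s\<^sup>2 + u * s + v)) / of_int j"
        by (simp add: uU vV of_rat_add algebra_simps power2_eq_square)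
      then show ?thesis using w0[OF zy(1) sh[OF zy(2)]] by (simp only:)
    qed
    have F1r: "e1 \<in> \<int>" if "\<And>z y. z \<in> {z1, z2, z3} \<Longrightarrow> z = of_int r + of_int d * y \<Longrightarrow>
      algebraic_int (of_rat e0 + of_rat e1 * y)" for e0 e1
      by (rule F1) (rule that)
    have F2r: "of_int j * e2 \<in> \<int>" if "\<And>z y. z \<in> {z1, z2, z3} \<Longrightarrow> z = of_int r + of_int d * y \<Longrightarrow>
      algebraic_int (of_rat e0 + of_rat e1 * y + of_rat e2 * y\<^sup>2)" for e0 e1 e2
      by (rule F2) (rule that)
    show ?thesis
      by (intro conjI; rule index_core[where r = r and d = d and j = j and a = "a0 + 3 * s"
            and v = "s\<^sup>2 + u * s + v"], fact d, fact j0, fact F1r, fact F2r, fact a, fact yr, fact wr)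
  qed
  moreover have "int (ind (cubic (t, A, B))) = d ^ 3 * j"
    by (simp add: ind_eq[OF d1 d2] j power2_eq_square power3_eq_cube flip: d_def)
  moreover have "D dvd d" if "D > 0" "D dvd 3 * r + t" "D\<^sup>2 dvd 3 * r\<^sup>2 + 2 * t * r + A"
      "D ^ 3 dvd r ^ 3 + t * r\<^sup>2 + A * r + B" for D r
    unfolding d_def by (rule denominators_if_dvd(1)[OF d1(2) d2(2), of D 1 r]) (use that in auto)
  ultimately show ?thesis using d j0 a by (metis dvd_triv_left)
qed

end

lemma ind_structure:
  assumes "disc (t, A, B) \<noteq> 0"
  shows "\<exists>d j r. d > 0 \<and> j > 0 \<and> int (ind (cubic (t, A, B))) = d ^ 3 * j \<and> d dvd 3 * r + t \<and>
    d\<^sup>2 * j dvd 3 * r\<^sup>2 + 2 * t * r + A \<and> d ^ 3 * j\<^sup>2 dvd r ^ 3 + t * r\<^sup>2 + A * r + B \<and>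
    (\<forall>D r. D > 0 \<longrightarrow> D dvd 3 * r + t \<longrightarrow> D\<^sup>2 dvd 3 * r\<^sup>2 + 2 * t * r + A \<longrightarrow>
      D ^ 3 dvd r ^ 3 + t * r\<^sup>2 + A * r + B \<longrightarrow> D dvd d)"
  using cubic_roots_exist[OF assms] cubic_roots.index_structure by blast

lemma dvd_ind:
  fixes D J r :: int
  assumes "disc (t, A, B) \<noteq> 0"
    and "D > 0" "J > 0" "D dvd 3 * r + t" "D\<^sup>2 * J dvd 3 * r\<^sup>2 + 2 * t * r + A"
      "D ^ 3 * J\<^sup>2 dvd r ^ 3 + t * r\<^sup>2 + A * r + B"
  shows "D ^ 3 * J dvd int (ind (cubic (t, A, B)))"
  using cubic_roots_exist[OF assms(1)] cubic_roots.dvd_ind assms(2-) by blast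

subsection \<open>Deep roots\<close>

lemma dvd_if_prime_powers_dvd:
  fixes x y :: int
  assumes "x \<noteq> 0" "\<And>p. prime p \<Longrightarrow> p ^ multiplicity p x dvd y"
  shows "x dvd y"
proof (cases "y = 0")
  case False
  show ?thesis
  proof (rule multiplicity_le_imp_dvd)
    fix p :: int assume p: "prime p"
    then show "multiplicity p x \<le> multiplicity p y"
      using assms(2)[OF p] False by (intro multiplicity_geI) auto
  qed (use assms in auto)
qed simp

lemma prime_multiplicity_power:
  assumes "prime (p :: int)" "x \<noteq> 0"
  shows "multiplicity p (x ^ i) = i * multiplicity p x"
  by (rule prime_elem_multiplicity_power_distrib) (use assms in auto)

lemma prime_multiplicity_mult:
  assumes "prime (p :: int)" "x \<noteq> 0" "y \<noteq> 0"
  shows "multiplicity p (x * y) = multiplicity p x + multiplicity p y"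
  by (rule prime_elem_multiplicity_mult_distrib) (use assms in auto)

text \<open>At a prime \<open>p\<close> with exponent \<open>e\<close> in \<open>n\<close>, content exponents \<open>k\<close> are capped at \<open>\<lfloor>(e + 1)/3\<rfloor>\<close>.
  Then \<open>2 k + max(e - 3 k, 0) \<le> e\<close>, so that the modulus for \<open>A\<close> divides \<open>n\<close>, and at the cap
  \<open>e - 3 k \<le> 1\<close>, where \<open>r\<close> is unique without any primitivity condition because a cubic has at
  most one multiple root modulo \<open>p\<close>.\<close>

definition threshold :: "int \<Rightarrow> int" where
  "threshold n = (\<Prod>p\<in>prime_factors n. p ^ ((multiplicity p n + 1) div 3))"

definition root_content :: "int \<Rightarrow> int \<Rightarrow> int" where
  "root_content n a = gcd a (threshold n)"

text \<open>For positive \<open>n\<close> and \<open>m\<close>, this is the least positive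
  \<open>q\<close> such that \<open>n\<close> divides \<open>m ^ 3 * q\<close>.\<close>

definition cofactor :: "int \<Rightarrow> int \<Rightarrow> int" where
  "cofactor n m = n div gcd n (m ^ 3)"

text \<open>These are the hypotheses of \<open>dvd_ind\<close> for \<open>D = m\<close> and
  \<open>J = q\<close>; the remaining one, \<open>m dvd 3 * r + t\<close>, holds by
  construction.\<close>

definition deep_root :: "int \<Rightarrow> int \<Rightarrow> int \<Rightarrow> int \<Rightarrow> int \<Rightarrow> bool" where
  "deep_root n t A B r \<longleftrightarrow> (let m = root_content n (3 * r + t); q = cofactor n m in
     m\<^sup>2 * q dvd 3 * r\<^sup>2 + 2 * t * r + A \<and> m ^ 3 * q\<^sup>2 dvd r ^ 3 + t * r\<^sup>2 + A * r + B)"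

lemma threshold_pos: "threshold n > 0"
  unfolding threshold_def by (intro prod_pos) (auto simp: in_prime_factors_iff prime_gt_0_int)

lemma multiplicity_threshold:
  assumes "prime p" shows "multiplicity p (threshold n) = (multiplicity p n + 1) div 3"
proof -
  have "multiplicity p (threshold n) =
    (if p \<in> prime_factors n then (multiplicity p n + 1) div 3 else 0)"
    unfolding threshold_def by (rule multiplicity_prod_prime_powers) (use assms in auto)
  then show ?thesis using assms by (auto simp: prime_factors_multiplicity)
qed

lemma root_content_pos: "root_content n a > 0"
  using threshold_pos[of n] unfolding root_content_def by (metis gcd_pos_int less_irrefl)

lemma root_content_dvd: "root_content n a dvd a" unfolding root_content_def by simp

lemma cofactor_mult:
  shows "gcd n (m ^ 3) * cofactor n m = n"
  unfolding cofactor_def by simp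

lemma cofactor_pos: assumes "n > 0" shows "cofactor n m > 0"
  using cofactor_mult[of n m] assms gcd_ge_0_int[of n "m ^ 3"] by (metis less_eq_int_code(1) zero_less_mult_pos order_le_less mult_zero_left)

lemma dvd_cube_cofactor: "n dvd m ^ 3 * cofactor n m"
  by (metis cofactor_mult gcd_dvd2 mult_dvd_mono dvd_refl)

lemma multiplicity_cofactor:
  assumes "n > 0" "m > 0" "prime p"
  shows "multiplicity p (cofactor n m) = multiplicity p n - 3 * multiplicity p m"
proof -
  have "multiplicity p n = multiplicity p (gcd n (m ^ 3)) + multiplicity p (cofactor n m)"
    using prime_elem_multiplicity_mult_distrib[of p "gcd n (m ^ 3)" "cofactor n m"] cofactor_mult[of n m]
      cofactor_pos[OF assms(1), of m] assms by auto
  moreover have "multiplicity p (gcd n (m ^ 3)) = min (multiplicity p n) (multiplicity p (m ^ 3))"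
    using assms by (intro multiplicity_gcd) auto
  moreover have "multiplicity p (m ^ 3) = 3 * multiplicity p m"
    using assms by (simp add: prime_multiplicity_power)
  ultimately show ?thesis by (simp add: min_def split: if_splits)
qed

lemma multiplicity_content:
  fixes p n a :: int
  assumes "prime p" defines "k \<equiv> multiplicity p (root_content n a)" and "e \<equiv> multiplicity p n"
  shows "k \<le> (e + 1) div 3" "p ^ k dvd a" "k = (e + 1) div 3 \<or> \<not> p ^ Suc k dvd a"
proof -
  have c0: "root_content n a \<noteq> 0" using root_content_pos[of n a] by simp
  have p: "\<not> is_unit p" using assms(1) by auto
  have le: "p ^ i dvd root_content n a \<longleftrightarrow> i \<le> k" for i
    unfolding k_def using power_dvd_iff_le_multiplicity[of "root_content n a" p i] c0 p by blast
  have th: "p ^ i dvd threshold n \<longleftrightarrow> i \<le> (e + 1) div 3" for i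
    using power_dvd_iff_le_multiplicity[of "threshold n" p i] p threshold_pos[of n]
      multiplicity_threshold[OF assms(1), of n] e_def by auto
  have ct: "p ^ i dvd root_content n a \<longleftrightarrow> p ^ i dvd a \<and> i \<le> (e + 1) div 3" for i
    unfolding root_content_def using th by auto
  show "k \<le> (e + 1) div 3" "p ^ k dvd a" using le[of k] ct[of k] by auto
  show "k = (e + 1) div 3 \<or> \<not> p ^ Suc k dvd a"
    using le[of "Suc k"] ct[of "Suc k"] \<open>k \<le> (e + 1) div 3\<close> by auto
qed

lemma multiplicity_content_cofactor:
  fixes p n a :: int
  assumes "n > 0" "prime p"
  defines "m \<equiv> root_content n a"
  defines "k \<equiv> multiplicity p m" and "l \<equiv> multiplicity p n - 3 * multiplicity p m"
  shows "multiplicity p (m ^ i * cofactor n m ^ j) = i * k + j * l"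
proof -
  have "m > 0" "cofactor n m > 0"
    using root_content_pos cofactor_pos assms by (auto simp: m_def)
  then show ?thesis
    using multiplicity_cofactor[OF assms(1) \<open>m > 0\<close> assms(2)] assms(2)
    by (simp add: prime_multiplicity_mult prime_multiplicity_power k_def l_def)
qed

text \<open>Everything reduces to the exponents at one prime, where the cap on \<open>m\<close>
  enters. The first two divisibilities bound the moduli for \<open>A\<close> and \<open>B\<close>;
  the third makes \<open>root_content\<close> unchanged when \<open>r\<close> moves by a multiple of
  \<open>m * q\<close>.\<close>

lemma content_cofactor_dvd:
  fixes n a :: int
  assumes n: "n > 0" defines "m \<equiv> root_content n a"
  shows "m\<^sup>2 * cofactor n m dvd n" "m ^ 3 * (cofactor n m)\<^sup>2 dvd n\<^sup>2" "threshold n dvd m * cofactor n m"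
proof -
  have pos: "m > 0" "cofactor n m > 0"
    using root_content_pos cofactor_pos n by (auto simp: m_def)
  have m: "multiplicity p (m ^ i * cofactor n m ^ j)
      = i * multiplicity p m + j * (multiplicity p n - 3 * multiplicity p m)"
      "multiplicity p m \<le> (multiplicity p n + 1) div 3" if "prime p" for p i j
    using multiplicity_content_cofactor[OF n that, of a] multiplicity_content(1)[OF that, of n a]
    by (auto simp: m_def)
  show "m\<^sup>2 * cofactor n m dvd n"
  proof (rule multiplicity_le_imp_dvd)
    fix p :: int assume p: "prime p"
    show "multiplicity p (m\<^sup>2 * cofactor n m) \<le> multiplicity p n"
      using m(1)[OF p, of 2 1] m(2)[OF p] by simp
  qed (use pos in simp)
  show "m ^ 3 * (cofactor n m)\<^sup>2 dvd n\<^sup>2"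
  proof (rule multiplicity_le_imp_dvd)
    fix p :: int assume p: "prime p"
    have "multiplicity p (n\<^sup>2) = 2 * multiplicity p n"
      using p n by (simp add: prime_multiplicity_power)
    then show "multiplicity p (m ^ 3 * (cofactor n m)\<^sup>2) \<le> multiplicity p (n\<^sup>2)"
      using m(1)[OF p, of 3 2] m(2)[OF p] by simp presburger
  qed (use pos in simp)
  show "threshold n dvd m * cofactor n m"
  proof (rule dvd_if_prime_powers_dvd)
    fix p :: int assume p: "prime p"
    let ?e = "multiplicity p n" and ?k = "multiplicity p m"
    have "(?e + 1) div 3 \<le> ?k + (?e - 3 * ?k)" using m(2)[OF p] by linarith
    then have "multiplicity p (threshold n) \<le> multiplicity p (m * cofactor n m)"
      using m(1)[OF p, of 1 1] multiplicity_threshold[OF p, of n] by simp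
    then show "p ^ multiplicity p (threshold n) dvd m * cofactor n m" by (rule multiplicity_dvd')
  qed (use threshold_pos[of n] in simp)
qed

text \<open>With \<open>s = m q \<sigma>\<close>, every term of the Taylor expansions at
  \<open>r\<close> is divisible by the modulus concerned. Hence \<open>r\<close> matters only modulo
  \<open>m q\<close>.\<close>

lemma deep_root_shift:
  assumes n: "n > 0" and r: "deep_root n t A B r"
    and s: "root_content n (3 * r + t) * cofactor n (root_content n (3 * r + t)) dvd s"
  shows "root_content n (3 * (r + s) + t) = root_content n (3 * r + t)" "deep_root n t A B (r + s)"
proof -
  define m where "m = root_content n (3 * r + t)"
  define q where "q = cofactor n m"
  have s': "m * q dvd s" using s by (simp add: m_def q_def)
  then obtain \<sigma> where \<sigma>: "s = m * q * \<sigma>" by (auto elim: dvdE)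
  have "threshold n dvd s"
    using content_cofactor_dvd(3)[OF n, of "3 * r + t"] s' dvd_trans by (auto simp: m_def q_def)
  then have th: "threshold n dvd 3 * s" by simp
  show c: "root_content n (3 * (r + s) + t) = root_content n (3 * r + t)"
  proof -
    have "3 * (r + s) + t = (3 * r + t) + 3 * s" by simp
    moreover obtain w where "3 * s = threshold n * w" using th by (auto elim: dvdE)
    ultimately have "3 * (r + s) + t = w * threshold n + (3 * r + t)" by (simp add: mult.commute)
    then show ?thesis unfolding root_content_def by (metis gcd.commute gcd_add_mult)
  qed
  obtain \<alpha> where a: "3 * r + t = m * \<alpha>" using root_content_dvd[of n "3 * r + t"] by (auto simp: m_def elim: dvdE)
  obtain \<beta> where b: "3 * r\<^sup>2 + 2 * t * r + A = m\<^sup>2 * q * \<beta>"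
    using r by (auto simp: deep_root_def Let_def m_def q_def elim: dvdE)
  obtain \<gamma> where c': "r ^ 3 + t * r\<^sup>2 + A * r + B = m ^ 3 * q\<^sup>2 * \<gamma>"
    using r by (auto simp: deep_root_def Let_def m_def q_def elim: dvdE)
  have "3 * (r + s)\<^sup>2 + 2 * t * (r + s) + A = (3 * r\<^sup>2 + 2 * t * r + A) + 2 * (3 * r + t) * s + 3 * s\<^sup>2"
    by (simp add: algebra_simps power2_eq_square)
  also have "\<dots> = m\<^sup>2 * q * (\<beta> + 2 * \<alpha> * \<sigma> + 3 * q * \<sigma>\<^sup>2)"
    unfolding a b \<sigma> by (simp add: algebra_simps power2_eq_square)
  finally have 1: "m\<^sup>2 * q dvd 3 * (r + s)\<^sup>2 + 2 * t * (r + s) + A" by simp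
  have "(r + s) ^ 3 + t * (r + s)\<^sup>2 + A * (r + s) + B = (r ^ 3 + t * r\<^sup>2 + A * r + B)
      + (3 * r\<^sup>2 + 2 * t * r + A) * s + (3 * r + t) * s\<^sup>2 + s ^ 3"
    by (simp add: algebra_simps power2_eq_square power3_eq_cube)
  also have "\<dots> = m ^ 3 * q\<^sup>2 * (\<gamma> + \<beta> * \<sigma> + \<alpha> * \<sigma>\<^sup>2 + q * \<sigma> ^ 3)"
    unfolding a b c' \<sigma> by (simp add: algebra_simps power2_eq_square power3_eq_cube)
  finally have 2: "m ^ 3 * q\<^sup>2 dvd (r + s) ^ 3 + t * (r + s)\<^sup>2 + A * (r + s) + B" by simp
  show "deep_root n t A B (r + s)"
    unfolding deep_root_def Let_def c using 1 2 by (simp add: m_def q_def)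
qed

section \<open>Uniqueness of deep roots, one prime at a time\<close>

text \<open>\<open>s / P\<close> is a rational root of a monic integral cubic, hence an
  integer.\<close>

lemma dvd_of_cubic:
  fixes P a b s :: int
  assumes "P > 0" "P dvd a" "P\<^sup>2 dvd b" "P ^ 3 dvd s ^ 3 + a * s\<^sup>2 + b * s"
  shows "P dvd s"
proof -
  obtain a' b' c' where e: "a = P * a'" "b = P\<^sup>2 * b'" "s ^ 3 + a * s\<^sup>2 + b * s = P ^ 3 * c'"
    using assms by (meson dvdE)
  define x :: complex where "x = of_int s / of_int P"
  have P: "of_int P \<noteq> (0::complex)" using assms(1) by simp
  have s: "of_int s = of_int P * x" using P by (simp add: x_def)
  have "of_int (s ^ 3 + (P * a') * s\<^sup>2 + (P\<^sup>2 * b') * s) = (of_int (P ^ 3 * c') :: complex)"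
    using e by simp
  then have "of_int P ^ 3 * (x ^ 3 + of_int a' * x\<^sup>2 + of_int b' * x - of_int c') = 0"
    by (simp add: s algebra_simps power2_eq_square power3_eq_cube)
  then have "x ^ 3 + of_int a' * x\<^sup>2 + of_int b' * x + of_int (- c') = 0" using P by simp
  then have "algebraic_int x" by (rule algebraic_int_monic_cubic)
  then have "x \<in> \<int>" by (rule rational_algebraic_int_is_int) (simp add: x_def)
  then obtain k where "x = of_int k" by (auto elim: Ints_cases)
  then have "of_int s = (of_int (P * k) :: complex)" by (simp add: s)
  then show ?thesis by (simp only: of_int_eq_iff) simp
qed

text \<open>Here \<open>a, b, c\<close> are \<open>f''(r)/2, f'(r), f(r)\<close>, and the shifted
  expressions are their values at \<open>r + s\<close>. If \<open>k < k'\<close>, the cap gives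
  \<open>e - 3 * k \<ge> 2\<close>, so \<open>f\<close> vanishes modulo
  \<open>p ^ (3 * Suc k)\<close> at both points. Expanding at \<open>r + s\<close>, which has
  content at least \<open>Suc k\<close>, \<open>dvd_of_cubic\<close> forces \<open>p ^ Suc k\<close>
  to divide \<open>s\<close> and therefore \<open>a\<close>, against the choice of
  \<open>k\<close>.\<close>

lemma local_content_le:
  fixes p a b c s :: int and e k k' :: nat
  assumes p: "prime p" and k: "k' \<le> (e + 1) div 3" "k = (e + 1) div 3 \<or> \<not> p ^ Suc k dvd a"
    and c: "p ^ (3 * k + 2 * (e - 3 * k)) dvd c"
    and a': "p ^ k' dvd a + 3 * s" and b': "p ^ (2 * k' + (e - 3 * k')) dvd b + 2 * a * s + 3 * s\<^sup>2"
    and c': "p ^ (3 * k' + 2 * (e - 3 * k')) dvd c + b * s + a * s\<^sup>2 + s ^ 3"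
  shows "k' \<le> k"
proof (rule ccontr)
  assume "\<not> k' \<le> k"
  then have k': "Suc k \<le> k'" by simp
  have ndvd: "\<not> p ^ Suc k dvd a" and le: "3 * Suc k \<le> 3 * k + 2 * (e - 3 * k)" using k k' by auto
  have a2: "p ^ Suc k dvd a + 3 * s" using a' k' power_le_dvd by blast
  have "p ^ Suc k dvd - s"
  proof (rule dvd_of_cubic[where a = "a + 3 * s" and b = "b + 2 * a * s + 3 * s\<^sup>2"])
    show "p ^ Suc k > 0" using prime_gt_0_int[OF p] by simp
    show "p ^ Suc k dvd a + 3 * s" by (rule a2)
    have "2 * Suc k \<le> 2 * k' + (e - 3 * k')" using k' by simp
    then show "(p ^ Suc k)\<^sup>2 dvd b + 2 * a * s + 3 * s\<^sup>2"
      using power_le_dvd[OF b'] by (simp only: power_mult[symmetric] mult.commute)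
    have "3 * Suc k \<le> 3 * k' + 2 * (e - 3 * k')" using k' by simp
    from power_le_dvd[OF c' this] power_le_dvd[OF c le]
    have "p ^ (3 * Suc k) dvd c - (c + b * s + a * s\<^sup>2 + s ^ 3)" by (rule dvd_diff[rotated])
    moreover have "c - (c + b * s + a * s\<^sup>2 + s ^ 3)
      = (- s) ^ 3 + (a + 3 * s) * (- s)\<^sup>2 + (b + 2 * a * s + 3 * s\<^sup>2) * (- s)"
      by (simp add: algebra_simps power2_eq_square power3_eq_cube)
    ultimately show "(p ^ Suc k) ^ 3 dvd (- s) ^ 3 + (a + 3 * s) * (- s)\<^sup>2 + (b + 2 * a * s + 3 * s\<^sup>2) * (- s)"
      by (simp only: power_mult[symmetric] mult.commute)
  qed
  then have "p ^ Suc k dvd (a + 3 * s) - 3 * s" using a2 by (intro dvd_diff) auto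
  then show False using ndvd by simp
qed

text \<open>Dividing out the content, with \<open>s = p ^ k * \<sigma>\<close>, leaves a statement
  about \<open>\<sigma>\<close> and the exponent \<open>l = e - 3 * k\<close>. For
  \<open>l \<le> 1\<close> a single factor \<open>p\<close> suffices; for \<open>l \<ge> 2\<close>
  the content lies below the cap, the cubic is primitive at the root, and the factor can be
  bootstrapped.\<close>

lemma local_root_unique:
  fixes p a b c s :: int and e k :: nat
  assumes p: "prime p" and k: "p ^ k dvd a" "k = (e + 1) div 3 \<or> \<not> p ^ Suc k dvd a"
    and b: "p ^ (2 * k + (e - 3 * k)) dvd b" and c: "p ^ (3 * k + 2 * (e - 3 * k)) dvd c"
    and b': "p ^ (2 * k + (e - 3 * k)) dvd b + 2 * a * s + 3 * s\<^sup>2"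
    and c': "p ^ (3 * k + 2 * (e - 3 * k)) dvd c + b * s + a * s\<^sup>2 + s ^ 3"
  shows "p ^ (k + (e - 3 * k)) dvd s"
proof -
  define l where "l = e - 3 * k"
  have p0: "p > 0" by (rule prime_gt_0_int[OF p])
  have "p ^ k dvd s"
  proof (rule dvd_of_cubic[where a = a and b = b])
    show "(p ^ k)\<^sup>2 dvd b" using b by (metis dvd_mult_left mult.commute power_add power_mult)
    have "p ^ (3 * k) dvd (c + b * s + a * s\<^sup>2 + s ^ 3) - c"
      using power_le_dvd[OF c, of "3 * k"] power_le_dvd[OF c', of "3 * k"] by (intro dvd_diff) auto
    then show "(p ^ k) ^ 3 dvd s ^ 3 + a * s\<^sup>2 + b * s"
      by (simp add: power_mult[symmetric] mult.commute algebra_simps)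
  qed (use p0 k in auto)
  then obtain \<sigma> where s: "s = p ^ k * \<sigma>" by (auto elim: dvdE)
  obtain \<alpha> where a: "a = p ^ k * \<alpha>" using k(1) by (auto elim: dvdE)
  obtain \<beta> where b0: "b = p ^ (2 * k + l) * \<beta>" using b by (auto simp: l_def elim: dvdE)
  obtain \<gamma> where c0: "c = p ^ (3 * k + 2 * l) * \<gamma>" using c by (auto simp: l_def elim: dvdE)
  have "b + 2 * a * s + 3 * s\<^sup>2 = p ^ (2 * k) * (p ^ l * \<beta> + \<sigma> * (2 * \<alpha> + 3 * \<sigma>))"
    unfolding s a b0 by (simp add: algebra_simps power2_eq_square power_add power_mult)
  then have "p ^ (2 * k) * p ^ l dvd p ^ (2 * k) * (p ^ l * \<beta> + \<sigma> * (2 * \<alpha> + 3 * \<sigma>))"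
    using b' by (simp add: l_def power_add)
  then have "p ^ l dvd p ^ l * \<beta> + \<sigma> * (2 * \<alpha> + 3 * \<sigma>)" using p0 by simp
  then have D1: "p ^ l dvd \<sigma> * (2 * \<alpha> + 3 * \<sigma>)" by (simp add: dvd_add_right_iff)
  have "c + b * s + a * s\<^sup>2 + s ^ 3 = p ^ (3 * k) * (p ^ (2 * l) * \<gamma> + (p ^ l * \<beta> * \<sigma> + \<sigma>\<^sup>2 * (\<alpha> + \<sigma>)))"
    unfolding s a b0 c0
    by (simp add: algebra_simps power2_eq_square power3_eq_cube power_add power_mult)
  then have "p ^ (3 * k) * p ^ (2 * l) dvd p ^ (3 * k) * (p ^ (2 * l) * \<gamma> + (p ^ l * \<beta> * \<sigma> + \<sigma>\<^sup>2 * (\<alpha> + \<sigma>)))"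
    using c' by (simp add: l_def power_add)
  then have "p ^ (2 * l) dvd p ^ (2 * l) * \<gamma> + (p ^ l * \<beta> * \<sigma> + \<sigma>\<^sup>2 * (\<alpha> + \<sigma>))" using p0 by simp
  then have D2: "p ^ (2 * l) dvd p ^ l * \<beta> * \<sigma> + \<sigma>\<^sup>2 * (\<alpha> + \<sigma>)" by (simp add: dvd_add_right_iff)
  \<comment> \<open>Otherwise the rescaled cubic would have two distinct multiple roots modulo
    \<open>p\<close>. Combining its conditions linearly isolates \<open>\<sigma>\<close>, also for
    the primes 2 and 3.\<close>
  have p\<sigma>: "p dvd \<sigma>" if l: "l \<ge> 1"
  proof (rule ccontr)
    assume n: "\<not> p dvd \<sigma>"
    have "p dvd p ^ l" "p dvd p ^ (2 * l)" using l by (auto intro: dvd_power)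
    then have "p dvd \<sigma> * (2 * \<alpha> + 3 * \<sigma>)" "p dvd p ^ l * \<beta> * \<sigma> + \<sigma>\<^sup>2 * (\<alpha> + \<sigma>)" "p dvd p ^ l * \<beta> * \<sigma>"
      using D1 D2 dvd_trans by auto
    then have "p dvd \<sigma> * (2 * \<alpha> + 3 * \<sigma>)" "p dvd \<sigma>\<^sup>2 * (\<alpha> + \<sigma>)" by (auto simp: dvd_add_right_iff)
    then have h: "p dvd 2 * \<alpha> + 3 * \<sigma>" "p dvd \<alpha> + \<sigma>"
      using n p by (auto simp: prime_dvd_mult_iff prime_dvd_power_iff)
    have "p dvd (2 * \<alpha> + 3 * \<sigma>) - 2 * (\<alpha> + \<sigma>)"
      by (rule dvd_diff[OF h(1) dvd_mult[OF h(2)]])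
    then show False using n by simp
  qed
  have "p ^ l dvd \<sigma>"
  proof (cases "l \<le> 1")
    case True
    then have "l = 0 \<or> l = 1" by auto
    then show ?thesis using p\<sigma> by auto
  next
    case False
    then have "k \<noteq> (e + 1) div 3" by (auto simp: l_def)
    then have "\<not> p ^ Suc k dvd a" using k by blast
    then have n\<alpha>: "\<not> p dvd \<alpha>" by (auto simp: a mult.commute)
    have n2: "\<not> p dvd \<alpha> + \<sigma>" using n\<alpha> p\<sigma> False by (simp add: dvd_add_left_iff)
    \<comment> \<open>Since \<open>\<alpha> + \<sigma>\<close> is prime to \<open>p\<close>,
      divisibility of \<open>\<sigma>\<close> by \<open>p ^ f\<close> with \<open>f < l\<close>
      makes \<open>p ^ (2 * f + 1)\<close> divide \<open>\<sigma>^2\<close>, which gains one more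
      factor \<open>p\<close>.\<close>
    have "p ^ Suc i dvd \<sigma>" if "Suc i \<le> l" for i
      using that
    proof (induction i)
      case 0
      then show ?case using p\<sigma> by simp
    next
      case (Suc i)
      define f where "f = Suc i"
      obtain \<tau> where \<tau>: "\<sigma> = p ^ f * \<tau>" using Suc by (auto simp: f_def elim: dvdE)
      have "Suc (2 * f) \<le> 2 * l" "Suc (2 * f) \<le> l + f" using Suc.prems by (auto simp: f_def)
      then have le: "p ^ Suc (2 * f) dvd p ^ (2 * l)" "p ^ Suc (2 * f) dvd p ^ (l + f)"
        using le_imp_power_dvd by blast+
      have "p ^ Suc (2 * f) dvd p ^ l * \<beta> * \<sigma> + \<sigma>\<^sup>2 * (\<alpha> + \<sigma>)" by (rule dvd_trans[OF le(1) D2])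
      moreover have "p ^ Suc (2 * f) dvd p ^ l * \<beta> * \<sigma>"
        using dvd_mult2[OF le(2), of "\<beta> * \<tau>"] by (simp add: \<tau> power_add mult_ac)
      ultimately have "p ^ Suc (2 * f) dvd \<sigma>\<^sup>2 * (\<alpha> + \<sigma>)" by (simp only: dvd_add_right_iff)
      moreover have "\<sigma>\<^sup>2 * (\<alpha> + \<sigma>) = p ^ (2 * f) * (\<tau>\<^sup>2 * (\<alpha> + \<sigma>))"
        unfolding \<tau> by (simp add: power_mult_distrib power_mult mult_ac)
      ultimately have "p ^ (2 * f) * p dvd p ^ (2 * f) * (\<tau>\<^sup>2 * (\<alpha> + \<sigma>))" by (simp only: power_Suc2)
      then have "p dvd \<tau>\<^sup>2 * (\<alpha> + \<sigma>)" using p0 by simp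
      then have "p dvd \<tau>" using n2 p by (auto simp: prime_dvd_mult_iff prime_dvd_power_iff)
      then have "p ^ f * p dvd \<sigma>" unfolding \<tau> by simp
      then show ?case by (simp add: f_def mult.commute)
    qed
    from this[of "l - 1"] show ?thesis using False by simp
  qed
  then show ?thesis unfolding s power_add l_def by simp
qed

lemma deep_root_prime_powers:
  fixes p n :: int
  assumes n: "n > 0" and p: "prime p" and r: "deep_root n t A B r"
  defines "k \<equiv> multiplicity p (root_content n (3 * r + t))"
  defines "l \<equiv> multiplicity p n - 3 * k"
  shows "p ^ (2 * k + l) dvd 3 * r\<^sup>2 + 2 * t * r + A"
    "p ^ (3 * k + 2 * l) dvd r ^ 3 + t * r\<^sup>2 + A * r + B"
proof -
  let ?m = "root_content n (3 * r + t)"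
  have "p ^ (2 * k + l) dvd ?m\<^sup>2 * cofactor n ?m"
    using multiplicity_content_cofactor[OF n p, of "3 * r + t" 2 1] multiplicity_dvd[of p "?m\<^sup>2 * cofactor n ?m"]
    by (simp add: k_def l_def)
  then show "p ^ (2 * k + l) dvd 3 * r\<^sup>2 + 2 * t * r + A"
    using r dvd_trans unfolding deep_root_def Let_def by blast
  have "p ^ (3 * k + 2 * l) dvd ?m ^ 3 * (cofactor n ?m)\<^sup>2"
    using multiplicity_content_cofactor[OF n p, of "3 * r + t" 3 2]
      multiplicity_dvd[of p "?m ^ 3 * (cofactor n ?m)\<^sup>2"]
    by (simp add: k_def l_def)
  then show "p ^ (3 * k + 2 * l) dvd r ^ 3 + t * r\<^sup>2 + A * r + B"
    using r dvd_trans unfolding deep_root_def Let_def by blast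
qed

lemma taylor_cubic:
  fixes r r' t A B :: int
  shows "3 * r' + t = (3 * r + t) + 3 * (r' - r)"
    "3 * r'\<^sup>2 + 2 * t * r' + A = (3 * r\<^sup>2 + 2 * t * r + A) + 2 * (3 * r + t) * (r' - r) + 3 * (r' - r)\<^sup>2"
    "r' ^ 3 + t * r'\<^sup>2 + A * r' + B = (r ^ 3 + t * r\<^sup>2 + A * r + B)
      + (3 * r\<^sup>2 + 2 * t * r + A) * (r' - r) + (3 * r + t) * (r' - r)\<^sup>2 + (r' - r) ^ 3"
  by (simp_all add: algebra_simps power2_eq_square power3_eq_cube)

lemma multiplicity_content_le:
  assumes n: "n > 0" and r: "deep_root n t A B r" and r': "deep_root n t A B r'" and p: "prime p"
  shows "multiplicity p (root_content n (3 * r' + t)) \<le> multiplicity p (root_content n (3 * r + t))"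
proof (rule local_content_le[OF p multiplicity_content(1)[OF p] multiplicity_content(3)[OF p]
      deep_root_prime_powers(2)[OF n p r]])
  let ?k' = "multiplicity p (root_content n (3 * r' + t))"
  show "p ^ ?k' dvd (3 * r + t) + 3 * (r' - r)"
    unfolding taylor_cubic(1)[symmetric] by (rule multiplicity_content(2)[OF p])
  show "p ^ (2 * ?k' + (multiplicity p n - 3 * ?k'))
      dvd (3 * r\<^sup>2 + 2 * t * r + A) + 2 * (3 * r + t) * (r' - r) + 3 * (r' - r)\<^sup>2"
    unfolding taylor_cubic(2)[symmetric] by (rule deep_root_prime_powers(1)[OF n p r'])
  show "p ^ (3 * ?k' + 2 * (multiplicity p n - 3 * ?k'))
      dvd (r ^ 3 + t * r\<^sup>2 + A * r + B) + (3 * r\<^sup>2 + 2 * t * r + A) * (r' - r) + (3 * r + t) * (r' - r)\<^sup>2 + (r' - r) ^ 3"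
    unfolding taylor_cubic(3)[symmetric] by (rule deep_root_prime_powers(2)[OF n p r'])
qed

lemma deep_root_unique:
  assumes n: "n > 0" and r: "deep_root n t A B r" and r': "deep_root n t A B r'"
  defines "m \<equiv> root_content n (3 * r + t)"
  shows "root_content n (3 * r' + t) = m" "m * cofactor n m dvd r' - r"
proof -
  have pos: "m > 0" "root_content n (3 * r' + t) > 0" "cofactor n m > 0"
    using root_content_pos cofactor_pos n by (auto simp: m_def)
  show eq: "root_content n (3 * r' + t) = m"
  proof (rule zdvd_antisym_nonneg)
    show "root_content n (3 * r' + t) dvd m" "m dvd root_content n (3 * r' + t)"
      using pos multiplicity_content_le[OF n r r'] multiplicity_content_le[OF n r' r]
      by (auto intro!: multiplicity_le_imp_dvd simp: m_def)
  qed (use pos in auto)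
  show "m * cofactor n m dvd r' - r"
  proof (rule dvd_if_prime_powers_dvd)
    fix p :: int assume p: "prime p"
    let ?k = "multiplicity p m"
    have k: "multiplicity p (root_content n (3 * r + t)) = ?k"
      "multiplicity p (root_content n (3 * r' + t)) = ?k" using eq by (simp_all add: m_def)
    have "p ^ (?k + (multiplicity p n - 3 * ?k)) dvd r' - r"
    proof (rule local_root_unique[OF p])
      show "p ^ ?k dvd 3 * r + t" using multiplicity_content(2)[OF p, of n "3 * r + t"] by (simp add: k)
      show "?k = (multiplicity p n + 1) div 3 \<or> \<not> p ^ Suc ?k dvd 3 * r + t"
        using multiplicity_content(3)[OF p, of n "3 * r + t"] unfolding k .
      show "p ^ (2 * ?k + (multiplicity p n - 3 * ?k)) dvd 3 * r\<^sup>2 + 2 * t * r + A"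
        using deep_root_prime_powers(1)[OF n p r] unfolding k .
      show "p ^ (3 * ?k + 2 * (multiplicity p n - 3 * ?k)) dvd r ^ 3 + t * r\<^sup>2 + A * r + B"
        using deep_root_prime_powers(2)[OF n p r] unfolding k .
      show "p ^ (2 * ?k + (multiplicity p n - 3 * ?k))
        dvd (3 * r\<^sup>2 + 2 * t * r + A) + 2 * (3 * r + t) * (r' - r) + 3 * (r' - r)\<^sup>2"
        using deep_root_prime_powers(1)[OF n p r'] unfolding k taylor_cubic(2)[of r' t A r] .
      show "p ^ (3 * ?k + 2 * (multiplicity p n - 3 * ?k))
        dvd (r ^ 3 + t * r\<^sup>2 + A * r + B) + (3 * r\<^sup>2 + 2 * t * r + A) * (r' - r) + (3 * r + t) * (r' - r)\<^sup>2 + (r' - r) ^ 3"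
        using deep_root_prime_powers(2)[OF n p r'] unfolding k taylor_cubic(3)[of r' t A B r] .
    qed
    moreover have "multiplicity p (m * cofactor n m) = ?k + (multiplicity p n - 3 * ?k)"
      using multiplicity_content_cofactor[OF n p, of "3 * r + t" 1 1] by (simp add: m_def)
    ultimately show "p ^ multiplicity p (m * cofactor n m) dvd r' - r" by simp
  qed (use pos in auto)
qed

section \<open>From the index to a deep root\<close>

text \<open>Exponents at one prime: \<open>e\<close> of \<open>n\<close>, \<open>k\<close> of the
  capped content, \<open>kd\<close> of \<open>d\<close>, \<open>J\<close> of \<open>j\<close>. If
  \<open>k < kd\<close>, then \<open>k\<close> is at the cap, so \<open>e \<le> 3 * k + 1\<close>.
  The case \<open>kd < k\<close> is impossible: there \<open>J \<le> 1\<close>, so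
  \<open>e \<le> 3 * kd + 1\<close>, contradicting \<open>3 * k \<le> e + 1\<close>.\<close>

lemma exponent_bounds:
  fixes e k kd J :: nat
  assumes "e \<le> 3 * kd + J" "k \<le> (e + 1) div 3" "kd \<le> k \<or> k = (e + 1) div 3" "J \<ge> 2 \<Longrightarrow> k \<le> kd"
  shows "2 * k + (e - 3 * k) \<le> 2 * kd + J" "3 * k + 2 * (e - 3 * k) \<le> 3 * kd + 2 * J"
proof -
  show "2 * k + (e - 3 * k) \<le> 2 * kd + J" using assms by linarith
  have "3 * k \<le> e + 1" using assms(2) by linarith
  consider "k = kd" | "k < kd" | "k > kd" by linarith
  then show "3 * k + 2 * (e - 3 * k) \<le> 3 * kd + 2 * J"
  proof cases
    case 1
    then show ?thesis using assms(1) by linarith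
  next
    case 2
    then have "e \<le> 3 * k + 1" using assms(3) by linarith
    then show ?thesis using 2 by linarith
  next
    case 3
    then have "J \<le> 1" using assms(4) by linarith
    then have "e \<le> 3 * kd + 1" using assms(1) by linarith
    then have False using 3 \<open>3 * k \<le> e + 1\<close> by linarith
    then show ?thesis ..
  qed
qed
text \<open>The same \<open>r\<close> works: at each prime the moduli built from \<open>m, q\<close>
  divide those built from \<open>d, j\<close>. The delicate point is to exclude a value
  \<open>3 * r + t\<close> more divisible than \<open>d\<close> when \<open>p^2\<close> divides
  \<open>j\<close>; this is where the maximality of \<open>d\<close> enters.\<close>

lemma exists_deep_root_if_structure:
  fixes n d j t A B r :: int
  assumes n: "n > 0" "n dvd d ^ 3 * j" and d: "d > 0" and j: "j > 0"
    and a: "d dvd 3 * r + t" and b: "d\<^sup>2 * j dvd 3 * r\<^sup>2 + 2 * t * r + A"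
    and c: "d ^ 3 * j\<^sup>2 dvd r ^ 3 + t * r\<^sup>2 + A * r + B"
    and max: "\<And>D. D > 0 \<Longrightarrow> D dvd 3 * r + t \<Longrightarrow> D\<^sup>2 dvd 3 * r\<^sup>2 + 2 * t * r + A \<Longrightarrow>
      D ^ 3 dvd r ^ 3 + t * r\<^sup>2 + A * r + B \<Longrightarrow> D dvd d"
  shows "deep_root n t A B r"
proof -
  define m where "m = root_content n (3 * r + t)"
  define q where "q = cofactor n m"
  have pos: "m > 0" "q > 0" using root_content_pos cofactor_pos n by (auto simp: m_def q_def)
  have exps: "2 * multiplicity p m + (multiplicity p n - 3 * multiplicity p m)
      \<le> 2 * multiplicity p d + multiplicity p j"
    "3 * multiplicity p m + 2 * (multiplicity p n - 3 * multiplicity p m)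
      \<le> 3 * multiplicity p d + 2 * multiplicity p j" if p: "prime p" for p
  proof -
    define e k kd J where "e = multiplicity p n" and "k = multiplicity p m"
      and "kd = multiplicity p d" and "J = multiplicity p j"
    have p1: "p > 0" "\<not> is_unit p" using p prime_gt_0_int by auto
    have "e \<le> multiplicity p (d ^ 3 * j)" unfolding e_def
      using n d j p1 by (intro dvd_imp_multiplicity_le) auto
    then have e: "e \<le> 3 * kd + J"
      using d j p by (simp add: prime_multiplicity_mult prime_multiplicity_power kd_def J_def)
    have k: "k \<le> (e + 1) div 3" "p ^ k dvd 3 * r + t" "k = (e + 1) div 3 \<or> \<not> p ^ Suc k dvd 3 * r + t"
      using multiplicity_content[OF p, of n "3 * r + t"] by (simp_all add: k_def e_def m_def)
    have "p ^ kd dvd 3 * r + t" using a multiplicity_dvd[of p d] dvd_trans unfolding kd_def by blast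
    then have kd: "p ^ i dvd 3 * r + t" if "i \<le> kd" for i using that power_le_dvd by blast
    have kd_le: "kd \<le> k \<or> k = (e + 1) div 3" using k(3) kd[of "Suc k"] not_less_eq_eq by blast
    have ndvd: "\<not> p ^ Suc kd dvd 3 * r + t" if J2: "J \<ge> 2"
    proof
      \<comment> \<open>The square factor in \<open>j\<close> already gives \<open>p * d\<close> the
        divisibilities of \<open>f'(r)\<close> and \<open>f(r)\<close>. With this assumption it
        would pass all three content tests, although it does not divide \<open>d\<close>.\<close>
      assume "p ^ Suc kd dvd 3 * r + t"
      obtain a' where a': "3 * r + t = d * a'" using a by (auto elim: dvdE)
      obtain d' where d': "d = p ^ kd * d'" "\<not> p dvd d'"
        using multiplicity_decompose'[of d p] d p1 by (auto simp: kd_def)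
      have "p ^ kd * p dvd p ^ kd * (d' * a')" using \<open>p ^ Suc kd dvd 3 * r + t\<close> unfolding a' d'(1) power_Suc by (simp only: mult_ac)
      then have "p dvd d' * a'" using p1 by simp
      then have "p dvd a'" using d' p by (simp add: prime_dvd_mult_iff)
      then have "p * d dvd 3 * r + t" unfolding a' by (simp add: mult.commute)
      moreover have pj: "p\<^sup>2 dvd j" using J2 unfolding J_def by (rule multiplicity_dvd')
      have "d\<^sup>2 * p\<^sup>2 dvd d\<^sup>2 * j" using pj by (intro mult_dvd_mono) auto
      then have "(p * d)\<^sup>2 dvd 3 * r\<^sup>2 + 2 * t * r + A"
        using b dvd_trans by (auto simp: power_mult_distrib mult.commute)
      moreover have "p ^ 3 dvd j\<^sup>2"
      proof -
        have "(p\<^sup>2)\<^sup>2 dvd j\<^sup>2" using pj by (rule dvd_power_same)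
        moreover have "p ^ 3 dvd (p\<^sup>2)\<^sup>2" unfolding power_mult[symmetric] by (rule le_imp_power_dvd) simp
        ultimately show ?thesis using dvd_trans by blast
      qed
      then have "d ^ 3 * p ^ 3 dvd d ^ 3 * j\<^sup>2" by (intro mult_dvd_mono) auto
      then have "(p * d) ^ 3 dvd r ^ 3 + t * r\<^sup>2 + A * r + B"
        using c dvd_trans by (auto simp: power_mult_distrib mult.commute)
      ultimately have "p * d dvd d" using max[of "p * d"] p1 d by auto
      then show False using d p1 by simp
    qed
    have kle: "J \<ge> 2 \<Longrightarrow> k \<le> kd"
    proof (rule ccontr)
      assume "J \<ge> 2" "\<not> k \<le> kd"
      then show False using ndvd k(2) power_le_dvd[of p k "3 * r + t" "Suc kd"] by auto
    qed
    show "2 * multiplicity p m + (multiplicity p n - 3 * multiplicity p m) \<le> 2 * multiplicity p d + multiplicity p j"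
      "3 * multiplicity p m + 2 * (multiplicity p n - 3 * multiplicity p m) \<le> 3 * multiplicity p d + 2 * multiplicity p j"
      unfolding e_def[symmetric] k_def[symmetric] kd_def[symmetric] J_def[symmetric]
      by (rule exponent_bounds[OF e k(1) kd_le kle], assumption)+
  qed
  have 1: "m\<^sup>2 * q dvd d\<^sup>2 * j"
  proof (rule multiplicity_le_imp_dvd)
    fix p :: int assume p: "prime p"
    show "multiplicity p (m\<^sup>2 * q) \<le> multiplicity p (d\<^sup>2 * j)"
      using exps(1)[OF p] multiplicity_content_cofactor[OF n(1) p, of "3 * r + t" 2 1] d j p
      by (simp add: m_def q_def prime_multiplicity_mult prime_multiplicity_power)
  qed (use pos in simp)
  have 2: "m ^ 3 * q\<^sup>2 dvd d ^ 3 * j\<^sup>2"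
  proof (rule multiplicity_le_imp_dvd)
    fix p :: int assume p: "prime p"
    show "multiplicity p (m ^ 3 * q\<^sup>2) \<le> multiplicity p (d ^ 3 * j\<^sup>2)"
      using exps(2)[OF p] multiplicity_content_cofactor[OF n(1) p, of "3 * r + t" 3 2] d j p
      by (simp add: m_def q_def prime_multiplicity_mult prime_multiplicity_power)
  qed (use pos in simp)
  show ?thesis
    unfolding deep_root_def Let_def
    using dvd_trans[OF 1 b] dvd_trans[OF 2 c] by (simp add: m_def q_def)
qed

lemma exists_deep_root:
  assumes "(t, A, B) \<in> Defs.Sigma n" "n \<ge> 1"
  shows "\<exists>r. deep_root (int n) t A B r \<and>
    r \<in> {0..<root_content (int n) (3 * r + t) * cofactor (int n) (root_content (int n) (3 * r + t))}"
proof -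
  have S: "disc (t, A, B) \<noteq> 0" "n dvd ind (cubic (t, A, B))"
    using assms(1) by (auto simp: Defs.Sigma_def)
  obtain d j r where *: "d > 0" "j > 0" "int (ind (cubic (t, A, B))) = d ^ 3 * j" "d dvd 3 * r + t"
    "d\<^sup>2 * j dvd 3 * r\<^sup>2 + 2 * t * r + A" "d ^ 3 * j\<^sup>2 dvd r ^ 3 + t * r\<^sup>2 + A * r + B"
    "\<And>D r. D > 0 \<Longrightarrow> D dvd 3 * r + t \<Longrightarrow> D\<^sup>2 dvd 3 * r\<^sup>2 + 2 * t * r + A \<Longrightarrow>
      D ^ 3 dvd r ^ 3 + t * r\<^sup>2 + A * r + B \<Longrightarrow> D dvd d"
    using ind_structure[OF S(1)] by metis
  have n: "int n > 0" using assms(2) by simp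
  have "int n dvd d ^ 3 * j" using S(2) by (simp flip: *(3))
  then have r: "deep_root (int n) t A B r"
    by (intro exists_deep_root_if_structure[OF n _ *(1,2,4,5,6)]) (use *(7) in blast)+
  define M where "M = root_content (int n) (3 * r + t) * cofactor (int n) (root_content (int n) (3 * r + t))"
  have M: "M > 0" unfolding M_def by (intro mult_pos_pos root_content_pos cofactor_pos n)
  have "M dvd r mod M - r" by (metis dvd_minus_mod minus_diff_eq dvd_minus_iff)
  from deep_root_shift[OF n r this[unfolded M_def]]
  have "root_content (int n) (3 * (r mod M) + t) = root_content (int n) (3 * r + t)"
    "deep_root (int n) t A B (r mod M)" by (simp_all flip: M_def)
  then show ?thesis using M by (intro exI[of _ "r mod M"]) (simp flip: M_def)
qed

lemma deep_root_imp_Sigma: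
  assumes "deep_root (int n) t A B r" "n \<ge> 1" "t \<in> {-1, 0, 1}" "disc (t, A, B) \<noteq> 0"
  shows "(t, A, B) \<in> Defs.Sigma n"
proof -
  define m where "m = root_content (int n) (3 * r + t)"
  have n: "int n > 0" using assms(2) by simp
  have "m ^ 3 * cofactor (int n) m dvd int (ind (cubic (t, A, B)))"
  proof (rule dvd_ind[OF assms(4)])
    show "m > 0" "cofactor (int n) m > 0" using root_content_pos cofactor_pos[OF n] by (auto simp: m_def)
    show "m dvd 3 * r + t" unfolding m_def by (rule root_content_dvd)
  qed (use assms(1) in \<open>simp_all add: deep_root_def Let_def m_def\<close>)
  then have "int n dvd int (ind (cubic (t, A, B)))" using dvd_cube_cofactor dvd_trans by blast
  then show ?thesis using assms by (auto simp: Defs.Sigma_def VZ_def)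
qed

subsection \<open>Residue classes of deep roots\<close>

text \<open>Each class is represented by its least nonnegative \<open>r\<close>. The bound may
  depend on \<open>r\<close> itself, because the content is constant along the class.\<close>

definition root_classes :: "int \<Rightarrow> (int \<times> int) set" where
  "root_classes n = (SIGMA t:{-1, 0, 1}.
     {r. 0 \<le> r \<and> r < root_content n (3 * r + t) * cofactor n (root_content n (3 * r + t))})"

definition modulus_A :: "int \<Rightarrow> int \<times> int \<Rightarrow> int" where
  "modulus_A n = (\<lambda>(t, r). (root_content n (3 * r + t))\<^sup>2 * cofactor n (root_content n (3 * r + t)))"

definition modulus_B :: "int \<Rightarrow> int \<times> int \<Rightarrow> int" where
  "modulus_B n = (\<lambda>(t, r). root_content n (3 * r + t) ^ 3 * (cofactor n (root_content n (3 * r + t)))\<^sup>2)"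

lemma deep_root_iff:
  "deep_root n t A B r \<longleftrightarrow> modulus_A n (t, r) dvd A + (3 * r\<^sup>2 + 2 * t * r) \<and>
    modulus_B n (t, r) dvd B + (r ^ 3 + t * r\<^sup>2 + A * r)"
proof -
  have "3 * r\<^sup>2 + 2 * t * r + A = A + (3 * r\<^sup>2 + 2 * t * r)"
    "r ^ 3 + t * r\<^sup>2 + A * r + B = B + (r ^ 3 + t * r\<^sup>2 + A * r)" by simp_all
  then show ?thesis by (simp only: deep_root_def Let_def modulus_A_def modulus_B_def prod.case)
qed

lemma modulus_pos:
  assumes "n > 0" shows "modulus_A n x > 0" "modulus_B n x > 0"
  by (cases x; simp only: modulus_A_def modulus_B_def prod.case;
      intro mult_pos_pos zero_less_power root_content_pos cofactor_pos assms)+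

lemma modulus_dvd:
  assumes "n > 0" shows "modulus_A n x dvd n" "modulus_B n x dvd n\<^sup>2"
  by (cases x; simp only: modulus_A_def modulus_B_def prod.case; rule content_cofactor_dvd[OF assms])+

lemma content_cofactor_bounds:
  assumes n: "n > 0" defines "m \<equiv> \<lambda>a. root_content n a"
  shows "(m a)\<^sup>2 * cofactor n (m a) \<le> n" "1 \<le> m a" "1 \<le> cofactor n (m a)" "(m a)\<^sup>2 \<le> n" "m a \<le> n"
    "m a * cofactor n (m a) \<le> n"
proof -
  show 1: "1 \<le> m a" "1 \<le> cofactor n (m a)"
    using root_content_pos[of n a] cofactor_pos[OF n, of "m a"] by (auto simp: m_def)
  show le: "(m a)\<^sup>2 * cofactor n (m a) \<le> n"
    using content_cofactor_dvd(1)[OF n, of a] n by (auto simp: m_def intro: zdvd_imp_le)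
  have "(m a)\<^sup>2 * 1 \<le> (m a)\<^sup>2 * cofactor n (m a)" using 1 by (intro mult_left_mono zero_le_power2)
  then show 2: "(m a)\<^sup>2 \<le> n" using le by simp
  have "m a * 1 \<le> m a * m a" using 1 by (intro mult_left_mono) auto
  then show "m a \<le> n" using 2 unfolding power2_eq_square by linarith
  have "m a * cofactor n (m a) * 1 \<le> m a * cofactor n (m a) * m a"
    using 1 by (intro mult_left_mono mult_nonneg_nonneg) linarith+
  also have "\<dots> = (m a)\<^sup>2 * cofactor n (m a)" by (simp add: power2_eq_square)
  finally show "m a * cofactor n (m a) \<le> n" using le by linarith
qed

lemma finite_root_classes:
  assumes "n > 0" shows "finite (root_classes n)"
proof (rule finite_subset)
  show "root_classes n \<subseteq> {-1, 0, 1} \<times> {0..n}"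
  proof
    fix x assume "x \<in> root_classes n"
    then obtain t r where x: "x = (t, r)" "t \<in> {-1, 0, 1}" "0 \<le> r"
      "r < root_content n (3 * r + t) * cofactor n (root_content n (3 * r + t))"
      by (auto simp: root_classes_def)
    then show "x \<in> {-1, 0, 1} \<times> {0..n}"
      using content_cofactor_bounds(6)[OF assms, of "3 * r + t"] by auto
  qed
qed simp

section \<open>The number of classes\<close>

lemma sum_inverse_squares_le:
  assumes "n \<ge> 1" shows "(\<Sum>m=1..n. 1 / real m ^ 2) \<le> 2 - 1 / real n"
  using assms
proof (induction n rule: nat_induct_at_least)
  case (Suc n)
  have "1 / real (Suc n) ^ 2 \<le> 1 / (real n * real (Suc n))"
    unfolding power2_eq_square using Suc.hyps by (intro divide_left_mono mult_right_mono mult_pos_pos) auto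
  also have "\<dots> = 1 / real n - 1 / real (Suc n)" using Suc.hyps by (simp add: field_simps)
  finally have "1 / real (Suc n) ^ 2 \<le> 1 / real n - 1 / real (Suc n)" .
  then show ?case using Suc by simp
qed simp

text \<open>The pair \<open>(t, r)\<close> is recovered from \<open>a = 3 r + t\<close>, a multiple of its content \<open>m\<close> with
  \<open>- 1 \<le> a \<le> 3 m q\<close> and \<open>q \<le> n/m\<^sup>2\<close>; the count is dominated by \<open>\<Sum> n/m\<^sup>2\<close>.\<close>

lemma card_root_classes:
  assumes n: "n \<ge> 1" shows "real (card (root_classes (int n))) \<le> 10 * real n"
proof -
  have n0: "int n > 0" using n by simp
  define I where "I = (SIGMA m:{m \<in> {1..n}. m\<^sup>2 \<le> n}. {-1..3 * int n div (int m)\<^sup>2})"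
  define f where "f = (\<lambda>(t, r). (nat (root_content (int n) (3 * r + t)), (3 * r + t) div root_content (int n) (3 * r + t)))"
  have "card (root_classes (int n)) \<le> card I"
  proof (rule card_inj_on_le)
    show "inj_on f (root_classes (int n))"
    proof (rule inj_onI)
      fix x y assume xy: "x \<in> root_classes (int n)" "y \<in> root_classes (int n)" "f x = f y"
      obtain t r t' r' where e: "x = (t, r)" "y = (t', r')" by (metis surj_pair)
      let ?m = "root_content (int n) (3 * r + t)" and ?m' = "root_content (int n) (3 * r' + t')"
      have "?m = ?m'" "(3 * r + t) div ?m = (3 * r' + t') div ?m'"
        using xy(3) root_content_pos[of "int n"] by (auto simp: f_def e eq_nat_nat_iff less_imp_le)
      then have "3 * r + t = 3 * r' + t'"
        by (metis root_content_dvd dvd_mult_div_cancel)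
      moreover have "- 1 \<le> t \<and> t \<le> 1" "- 1 \<le> t' \<and> t' \<le> 1" using xy by (auto simp: root_classes_def e)
      then have "r = (3 * r + t + 1) div 3" "r' = (3 * r' + t' + 1) div 3" by linarith+
      ultimately have "r = r'" by simp
      then show "x = y" using \<open>3 * r + t = 3 * r' + t'\<close> unfolding e by simp
    qed
    show "f ` root_classes (int n) \<subseteq> I"
    proof (rule image_subsetI)
      fix x assume "x \<in> root_classes (int n)"
      then obtain t r where x: "x = (t, r)" "t \<in> {-1, 0, 1}" "0 \<le> r"
        "r < root_content (int n) (3 * r + t) * cofactor (int n) (root_content (int n) (3 * r + t))"
        by (auto simp: root_classes_def)
      define m where "m = root_content (int n) (3 * r + t)"
      define q where "q = cofactor (int n) m"
      note b = content_cofactor_bounds[OF n0, of "3 * r + t", folded m_def, folded q_def]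
      define u where "u = (3 * r + t) div m"
      have u: "3 * r + t = m * u"
        unfolding u_def m_def by (metis root_content_dvd dvd_mult_div_cancel)
      have "m * u \<ge> - 1" using x unfolding u[symmetric] by auto
      have u1: "u \<ge> -1"
      proof (rule ccontr)
        assume "\<not> u \<ge> -1"
        then have "m * u \<le> m * (- 2)" using b(2) by (intro mult_left_mono) auto
        then show False using \<open>m * u \<ge> - 1\<close> b(2) by linarith
      qed
      have "m * u \<le> m * (3 * q)"
        using x unfolding u[symmetric] m_def[symmetric] q_def[symmetric] by auto
      then have "u \<le> 3 * q" using b(2) by simp
      then have "m\<^sup>2 * u \<le> m\<^sup>2 * (3 * q)" by (intro mult_left_mono) auto
      then have "u * m\<^sup>2 \<le> 3 * int n" using b(1) by (simp add: mult_ac)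
      then have "u * m\<^sup>2 div m\<^sup>2 \<le> 3 * int n div m\<^sup>2" using b(2) by (intro zdiv_mono1) auto
      then have u2: "u \<le> 3 * int n div m\<^sup>2" using b(2) by simp
      have "(nat m)\<^sup>2 \<le> n"
        using b(2,4) by (metis nat_int nat_mono nat_power_eq order_trans zero_le_one)
      moreover have "nat m \<in> {1..n}" using b(2,5) by auto
      ultimately show "f x \<in> I" using u1 u2 b(2) by (simp add: f_def I_def x(1) flip: m_def u_def)
    qed
    show "finite I" unfolding I_def by (intro finite_SigmaI) auto
  qed
  also have "card I = (\<Sum>m\<in>{m \<in> {1..n}. m\<^sup>2 \<le> n}. card {-1..3 * int n div (int m)\<^sup>2})"
    unfolding I_def by (intro card_SigmaI) auto
  finally have "real (card (root_classes (int n)))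
      \<le> real (\<Sum>m\<in>{m \<in> {1..n}. m\<^sup>2 \<le> n}. card {-1..3 * int n div (int m)\<^sup>2})"
    by (simp only: of_nat_le_iff)
  also have "\<dots> = (\<Sum>m\<in>{m \<in> {1..n}. m\<^sup>2 \<le> n}. real (card {-1..3 * int n div (int m)\<^sup>2}))" by simp
  also have "\<dots> \<le> (\<Sum>m\<in>{m \<in> {1..n}. m\<^sup>2 \<le> n}. 5 * real n * (1 / real m ^ 2))"
  proof (rule sum_mono)
    fix m assume "m \<in> {m \<in> {1..n}. m\<^sup>2 \<le> n}"
    then have m: "m \<ge> 1" "real m ^ 2 \<le> real n" by (auto simp flip: of_nat_power)
    have "0 \<le> 3 * int n div (int m)\<^sup>2" using m(1) by (intro pos_imp_zdiv_nonneg_iff[THEN iffD2]) auto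
    then have "real (card {-1..3 * int n div (int m)\<^sup>2}) = real_of_int (3 * int n div (int m)\<^sup>2) + 2"
      by simp
    also have "real_of_int (3 * int n div (int m)\<^sup>2) \<le> 3 * real n / real m ^ 2"
      using real_of_int_div4[of "3 * int n" "(int m)\<^sup>2"] by simp
    \<comment> \<open>The condition \<open>m^2 \<le> n\<close> on the index set absorbs the two
      additional integers \<open>-1\<close> and \<open>0\<close> of the interval.\<close>
    also have "2 \<le> 2 * (real n / real m ^ 2)" using m by (simp add: field_simps)
    finally show "real (card {-1..3 * int n div (int m)\<^sup>2}) \<le> 5 * real n * (1 / real m ^ 2)" by simp
  qed
  also have "\<dots> \<le> (\<Sum>m=1..n. 5 * real n * (1 / real m ^ 2))" by (intro sum_mono2) auto
  also have "\<dots> = 5 * real n * (\<Sum>m=1..n. 1 / real m ^ 2)" by (simp add: sum_distrib_left)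
  also have "\<dots> \<le> 5 * real n * 2"
    using sum_inverse_squares_le[OF n] n by (intro mult_left_mono) (auto intro: order_trans)
  finally show ?thesis by simp
qed

section \<open>Counting integers in a residue class\<close>

lemma card_progression_le:
  fixes d c :: int and lo hi :: real
  assumes d: "d > 0" and le: "lo \<le> hi"
  shows "finite {x::int. lo \<le> x \<and> x \<le> hi \<and> d dvd x + c}"
    "real (card {x::int. lo \<le> x \<and> x \<le> hi \<and> d dvd x + c}) \<le> (hi - lo) / d + 1"
proof -
  let ?S = "{x::int. lo \<le> x \<and> x \<le> hi \<and> d dvd x + c}"
  let ?T = "{\<lceil>(lo + c) / d\<rceil>..\<lfloor>(hi + c) / d\<rfloor>}"
  have inj: "inj_on (\<lambda>x. (x + c) div d) ?S"
    by (rule inj_onI) (metis (mono_tags, lifting) add_right_cancel dvd_mult_div_cancel mem_Collect_eq)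
  have sub: "(\<lambda>x. (x + c) div d) ` ?S \<subseteq> ?T"
  proof (rule image_subsetI)
    fix x assume "x \<in> ?S"
    then have x: "lo \<le> x" "x \<le> hi" "real_of_int ((x + c) div d) = (x + c) / d"
      by (auto simp: real_of_int_div)
    have "(lo + c) / d \<le> (x + c) / d" "(x + c) / d \<le> (hi + c) / d"
      using x d by (auto intro!: divide_right_mono)
    then show "(x + c) div d \<in> ?T" using x(3) by (simp add: ceiling_le_iff le_floor_iff)
  qed
  show "finite ?S" using inj_on_finite[OF inj sub] by simp
  have "card ?S \<le> card ?T" by (rule card_inj_on_le[OF inj sub]) simp
  then have "real (card ?S) \<le> real (card ?T)" by simp
  also have "\<dots> \<le> (hi - lo) / d + 1"
  proof (cases "\<lceil>(lo + c) / d\<rceil> \<le> \<lfloor>(hi + c) / d\<rfloor> + 1")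
    case True
    then have "real (card ?T) = of_int \<lfloor>(hi + c) / d\<rfloor> - of_int \<lceil>(lo + c) / d\<rceil> + 1" by simp
    also have "\<dots> \<le> (hi + c) / d - (lo + c) / d + 1" by linarith
    also have "\<dots> = (hi - lo) / d + 1" by (simp add: diff_divide_distrib add_divide_distrib)
    finally show ?thesis .
  next
    case False
    then have "card ?T = 0" by simp
    then show ?thesis using d le by simp
  qed
  finally show "real (card ?S) \<le> (hi - lo) / d + 1" .
qed

lemma card_progression_ge:
  fixes d c L :: int
  assumes d: "d > 0" "d dvd L" and L: "L > 0"
  shows "real_of_int L / d \<le> real (card {x. 0 \<le> x \<and> x < L \<and> d dvd x + c})"
proof -
  let ?S = "{x. 0 \<le> x \<and> x < L \<and> d dvd x + c}"
  obtain k where k: "L = d * k" using d by (auto elim: dvdE)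
  have "k > 0" using L d k by (simp add: zero_less_mult_iff)
  have "card {0..<k} \<le> card ?S"
  proof (rule card_inj_on_le)
    show "inj_on (\<lambda>i. (- c) mod d + d * i) {0..<k}" using d by (auto simp: inj_on_def)
    show "(\<lambda>i. (- c) mod d + d * i) ` {0..<k} \<subseteq> ?S"
    proof (rule image_subsetI)
      fix i assume i: "i \<in> {0..<k}"
      have "(- c) mod d \<ge> 0" "(- c) mod d < d" using d by auto
      moreover have "d * i \<le> d * (k - 1)" using i d by (intro mult_left_mono) auto
      moreover have "0 \<le> d * i" using i d by simp
      moreover have "(- c) mod d + c = d * (- ((- c) div d))"
        by (simp flip: minus_mult_div_eq_mod)
      then have "d dvd (- c) mod d + c" by simp
      then have "d dvd ((- c) mod d + c) + d * i" by simp
      then have "d dvd (- c) mod d + d * i + c" by (simp add: algebra_simps)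
      ultimately show "(- c) mod d + d * i \<in> ?S" by (simp add: k algebra_simps)
    qed
    show "finite ?S" by (rule finite_subset[of _ "{0..<L}"]) auto
  qed
  moreover have "real_of_int L / d = real (card {0..<k})" using d \<open>k > 0\<close> by (simp add: k)
  ultimately show ?thesis by (metis of_nat_le_iff)
qed

subsection \<open>Density and count\<close>

text \<open>The sum of the Haar measures in \<open>(A, B)\<close> of all classes, taken over the
  three values of \<open>t\<close> without averaging; averaging over \<open>t\<close> later brings
  in the factor \<open>1 / 3\<close>.\<close>

definition class_density :: "nat \<Rightarrow> real" where
  "class_density n = (\<Sum>x\<in>root_classes (int n). 1 / (real_of_int (modulus_A (int n) x) * modulus_B (int n) x))"

text \<open>The discriminant is quadratic in \<open>B\<close> with leading coefficient -27, so its
  second difference with step \<open>L\<close> is \<open>- 54 * L^2\<close>.\<close>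

lemma exists_translate_disc_nonzero:
  assumes "L \<noteq> 0" shows "\<exists>k::int. disc (t, A, B + k * L) \<noteq> 0"
proof (rule ccontr)
  assume "\<not> ?thesis"
  then have "disc (t, A, B + 0 * L) = 0" "disc (t, A, B + 1 * L) = 0" "disc (t, A, B + 2 * L) = 0" by blast+
  moreover have "disc (t, A, B + 0 * L) - 2 * disc (t, A, B + 1 * L) + disc (t, A, B + 2 * L) = - 54 * L\<^sup>2"
    by (simp add: disc_def algebra_simps power2_eq_square)
  ultimately show False using assms by simp
qed

text \<open>The infimum runs over all moduli \<open>N\<close>, which need not be compatible with
  \<open>n\<close>. The classes are therefore counted at a finer modulus \<open>L\<close> and
  projected to residues modulo \<open>N\<close>.\<close>

lemma nu_Sigma_ge:
  assumes n: "n \<ge> 1" shows "class_density n / 3 \<le> nu (Defs.Sigma n)"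
  unfolding nu_def
proof (rule cINF_greatest)
  show "{N::nat. N \<ge> 1} \<noteq> {}" by auto
  fix N :: nat assume "N \<in> {N. N \<ge> 1}"
  then have N: "N \<ge> 1" by simp
  have n0: "int n > 0" using n by simp
  \<comment> \<open>A multiple of \<open>N\<close> and, through the factor \<open>n^2\<close>, of
    all moduli for \<open>A\<close> and \<open>B\<close>; so counting in a box of side
    \<open>L\<close> has no rounding loss.\<close>
  define L where "L = int N * (int n)\<^sup>2"
  have L: "L > 0" using N n by (simp add: L_def)
  define G where "G = (\<lambda>(t, A, B). (t :: int, A mod int N, B mod int N))"
  define T where "T = (\<lambda>(t, r). {t} \<times> (SIGMA A:{A. 0 \<le> A \<and> A < L \<and> modulus_A (int n) (t, r) dvd A + (3 * r\<^sup>2 + 2 * t * r)}.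
    {B. 0 \<le> B \<and> B < L \<and> modulus_B (int n) (t, r) dvd B + (r ^ 3 + t * r\<^sup>2 + A * r)}))"
  have fin0: "finite {x. 0 \<le> x \<and> x < L \<and> P x}" for P
    by (rule finite_subset[of _ "{0..<L}"]) auto
  have finT: "finite (T x)" for x
    unfolding T_def by (cases x) (auto intro!: finite_SigmaI fin0)
  have T_iff: "(t', A, B) \<in> T (t, r) \<longleftrightarrow> t' = t \<and> 0 \<le> A \<and> A < L \<and> 0 \<le> B \<and> B < L \<and> deep_root (int n) t A B r"
    for t' A B t r unfolding T_def deep_root_iff by auto
  have dL: "modulus_A (int n) x dvd L" "modulus_B (int n) x dvd L" for x
  proof -
    show "modulus_A (int n) x dvd L"
      using dvd_mult[OF modulus_dvd(1)[OF n0, of x], of "int N * int n"] by (simp add: L_def power2_eq_square mult_ac)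
    show "modulus_B (int n) x dvd L"
      unfolding L_def by (rule dvd_mult[OF modulus_dvd(2)[OF n0]])
  qed
  have cardT: "real_of_int L ^ 2 * (1 / (real_of_int (modulus_A (int n) x) * modulus_B (int n) x)) \<le> real (card (T x))" for x
  proof -
    obtain t r where x: "x = (t, r)" by (cases x)
    let ?SA = "{A. 0 \<le> A \<and> A < L \<and> modulus_A (int n) (t, r) dvd A + (3 * r\<^sup>2 + 2 * t * r)}"
    let ?SB = "\<lambda>A. {B. 0 \<le> B \<and> B < L \<and> modulus_B (int n) (t, r) dvd B + (r ^ 3 + t * r\<^sup>2 + A * r)}"
    let ?a = "real_of_int L / modulus_A (int n) x" and ?b = "real_of_int L / modulus_B (int n) x"
    have b0: "?b \<ge> 0" using L modulus_pos(2)[OF n0, of x] by simp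
    have "real_of_int L ^ 2 * (1 / (real_of_int (modulus_A (int n) x) * modulus_B (int n) x)) = ?a * ?b"
      by (simp add: power2_eq_square)
    also have "\<dots> \<le> real (card ?SA) * ?b"
      using card_progression_ge[OF modulus_pos(1)[OF n0] dL(1) L, of x] b0 unfolding x
      by (intro mult_right_mono) auto
    also have "\<dots> = (\<Sum>A\<in>?SA. ?b)" by simp
    also have "\<dots> \<le> (\<Sum>A\<in>?SA. real (card (?SB A)))"
      using card_progression_ge[OF modulus_pos(2)[OF n0] dL(2) L, of x] unfolding x by (intro sum_mono) auto
    also have "\<dots> = real (card (SIGMA A:?SA. ?SB A))"
      by (subst card_SigmaI) (auto intro!: fin0)
    also have "\<dots> = real (card (T x))"
      by (simp add: T_def x card_cartesian_product)
    finally show ?thesis .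
  qed
  have disj: "T x \<inter> T y = {}" if xy: "x \<in> root_classes (int n)" "y \<in> root_classes (int n)" "x \<noteq> y" for x y
  proof (rule ccontr)
    assume "T x \<inter> T y \<noteq> {}"
    then obtain t' A B where f: "(t', A, B) \<in> T x" "(t', A, B) \<in> T y" by auto
    obtain t r t2 r' where e0: "x = (t, r)" "y = (t2, r')" by (metis surj_pair)
    have "t2 = t" using f by (auto simp: e0 T_iff)
    with e0 have e: "x = (t, r)" "y = (t, r')" by simp_all
    have d: "deep_root (int n) t A B r" "deep_root (int n) t A B r'" using f by (auto simp: e T_iff)
    define M where "M = root_content (int n) (3 * r + t) * cofactor (int n) (root_content (int n) (3 * r + t))"
    have bounds: "0 \<le> r" "r < M" "0 \<le> r'" "r' < M"
      using xy(1,2) deep_root_unique(1)[OF n0 d] by (auto simp: e root_classes_def M_def)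
    have "r' - r = 0"
    proof (rule ccontr)
      assume "r' - r \<noteq> 0"
      moreover have "M dvd r' - r" using deep_root_unique(2)[OF n0 d] by (simp add: M_def)
      ultimately have "\<bar>M\<bar> \<le> \<bar>r' - r\<bar>" by (rule dvd_imp_le_int)
      then show False using bounds by linarith
    qed
    then show False using xy(3) e by simp
  qed
  define U where "U = (\<Union>x\<in>root_classes (int n). T x)"
  have "real (card U) = (\<Sum>x\<in>root_classes (int n). real (card (T x)))"
    unfolding U_def using finite_root_classes[OF n0] finT disj by (subst card_UN_disjoint) auto
  then have lower: "real_of_int L ^ 2 * class_density n \<le> real (card U)"
    unfolding class_density_def sum_distrib_left using cardT by (simp add: sum_mono)
  have finG: "finite (G ` Defs.Sigma n)"
  proof (rule finite_subset)
    show "G ` Defs.Sigma n \<subseteq> {-1, 0, 1} \<times> {0..<int N} \<times> {0..<int N}"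
      using N by (auto simp: G_def Defs.Sigma_def VZ_def)
  qed simp
  have GU: "G f \<in> G ` Defs.Sigma n" if f_U: "f \<in> U" for f
  proof -
    obtain x where x: "x \<in> root_classes (int n)" "f \<in> T x" using f_U by (auto simp: U_def)
    obtain t r where tr: "x = (t, r)" by (cases x)
    obtain t' A B where tAB: "f = (t', A, B)" by (cases f)
    have f: "f = (t, A, B)" "(t, r) \<in> root_classes (int n)" "deep_root (int n) t A B r"
      using x T_iff[of t' A B t r] by (simp_all add: tr tAB)
    \<comment> \<open>\<open>U\<close> may contain points of discriminant zero. Moving
      \<open>B\<close> by a multiple of \<open>L\<close> leaves both the deep root and the residues
      modulo \<open>N\<close> unchanged.\<close>
    obtain k where k: "disc (t, A, B + k * L) \<noteq> 0" using exists_translate_disc_nonzero[of L t A B] L by auto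
    have "deep_root (int n) t A (B + k * L) r"
    proof -
      have "B + k * L + (r ^ 3 + t * r\<^sup>2 + A * r) = (B + (r ^ 3 + t * r\<^sup>2 + A * r)) + k * L" by simp
      then show ?thesis
        using f(3) dvd_mult[OF dL(2)[of "(t, r)"], of k] unfolding deep_root_iff by (simp only: dvd_add)
    qed
    moreover have "t \<in> {-1, 0, 1}" using f(2) by (auto simp: root_classes_def)
    ultimately have "(t, A, B + k * L) \<in> Defs.Sigma n" using k n by (intro deep_root_imp_Sigma)
    moreover have "G (t, A, B + k * L) = G f"
    proof -
      have "k * L = int N * (k * (int n)\<^sup>2)" by (simp add: L_def)
      then have "(B + k * L) mod int N = B mod int N" by (metis mod_mult_self2)
      then show ?thesis by (simp add: G_def f)
    qed
    ultimately show ?thesis by (metis imageI)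
  qed
  \<comment> \<open>A point of the box is determined by its residues modulo \<open>N\<close> and by
    two quotients, each taking at most \<open>n^2\<close> values. So each residue class has at most
    \<open>n^4\<close> preimages.\<close>
  have "card U \<le> card ((G ` Defs.Sigma n) \<times> ({0..<(int n)\<^sup>2} \<times> {0..<(int n)\<^sup>2}))"
  proof (rule card_inj_on_le)
    let ?H = "\<lambda>f. (G f, (case f of (t, A, B) \<Rightarrow> (A div int N, B div int N)))"
    show "inj_on ?H U"
    proof (rule inj_onI)
      fix x y assume H: "?H x = ?H y"
      obtain t A B t' A' B' where e: "x = (t, A, B)" "y = (t', A', B')" by (metis prod_cases3)
      have eqI: "u = v" if "u mod int N = v mod int N" "u div int N = v div int N" for u v
        using that by (metis div_mult_mod_eq)
      show "x = y" using H eqI[of A A'] eqI[of B B'] by (simp add: e G_def)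
    qed
    have div: "x div int N \<in> {0..<(int n)\<^sup>2}" if "0 \<le> x" "x < L" for x
    proof -
      have "x div int N * int N \<le> x" using N by (simp flip: minus_mod_eq_div_mult)
      then have "x div int N * int N < (int n)\<^sup>2 * int N" using that(2) by (simp add: L_def mult.commute)
      then have "x div int N < (int n)\<^sup>2" by (rule mult_right_less_imp_less) simp
      then show ?thesis using that(1) N by (simp add: pos_imp_zdiv_nonneg_iff)
    qed
    show "?H ` U \<subseteq> (G ` Defs.Sigma n) \<times> ({0..<(int n)\<^sup>2} \<times> {0..<(int n)\<^sup>2})"
    proof (rule image_subsetI)
      fix f assume f: "f \<in> U"
      obtain t A B where e: "f = (t, A, B)" by (cases f)
      have "0 \<le> A" "A < L" "0 \<le> B" "B < L" using f T_iff by (auto simp: U_def e)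
      then show "?H f \<in> (G ` Defs.Sigma n) \<times> ({0..<(int n)\<^sup>2} \<times> {0..<(int n)\<^sup>2})"
        using GU[OF f] div by (simp add: e)
    qed
    show "finite ((G ` Defs.Sigma n) \<times> ({0..<(int n)\<^sup>2} \<times> {0..<(int n)\<^sup>2}))" using finG by simp
  qed
  also have "\<dots> = card (G ` Defs.Sigma n) * n ^ 4"
    by (simp add: card_cartesian_product nat_power_eq flip: power_add)
  finally have "real (card U) \<le> real (card (G ` Defs.Sigma n)) * real n ^ 4"
    by (metis of_nat_le_iff of_nat_mult of_nat_power)
  with lower have "real_of_int L ^ 2 * class_density n \<le> real (card (G ` Defs.Sigma n)) * real n ^ 4" by simp
  moreover have "real_of_int L ^ 2 = real N ^ 2 * real n ^ 4"
    by (simp add: L_def power_mult_distrib flip: power_mult)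
  ultimately have "(real N ^ 2 * class_density n) * real n ^ 4 \<le> real (card (G ` Defs.Sigma n)) * real n ^ 4"
    by (simp add: mult_ac)
  then have "real N ^ 2 * class_density n \<le> real (card (G ` Defs.Sigma n))" using n by simp
  then show "class_density n / 3 \<le> real (card ((\<lambda>(t, A, B). (t, A mod int N, B mod int N)) ` Defs.Sigma n)) / (3 * real N ^ 2)"
    unfolding G_def using N by (simp add: field_simps)
qed

section \<open>Bounds from height and discriminant\<close>

text \<open>The bounds on \<open>A\<close> and \<open>B\<close> are Vieta's relations. If all roots
  lie inside the unit disc, integrality forces \<open>B = 0\<close> and then \<open>A = 0\<close>,
  so the discriminant vanishes. Thus a nonempty count has \<open>Y > 1\<close>, which lets additive
  constants be absorbed into \<open>Y^2\<close>.\<close>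

lemma height_bounds:
  assumes d: "disc (t, A, B) \<noteq> 0" and h: "height (t, A, B) < Y"
  shows "\<bar>real_of_int A\<bar> \<le> 3 * Y\<^sup>2" "\<bar>real_of_int B\<bar> \<le> Y ^ 3" "Y > 1"
proof -
  obtain z1 z2 z3 where "cubic_roots t A B z1 z2 z3" using cubic_roots_exist[OF d] by blast
  then interpret cubic_roots t A B z1 z2 z3 .
  have "{cmod z | z. poly (map_poly of_int (cubic (t, A, B))) z = 0} = cmod ` {z1, z2, z3}"
    unfolding root_iff by auto
  then have "Max (cmod ` {z1, z2, z3}) < Y" using h unfolding height_def by simp
  then have z: "cmod z1 < Y" "cmod z2 < Y" "cmod z3 < Y" by auto
  have Y0: "Y \<ge> 0" using z(1) norm_ge_zero[of z1] by linarith
  have prod: "cmod (x * y) \<le> Y\<^sup>2" if "cmod x < Y" "cmod y < Y" for x y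
    unfolding norm_mult power2_eq_square using that Y0 by (intro mult_mono) auto
  have "\<bar>real_of_int A\<bar> = cmod (of_int A)" by simp
  also have "\<dots> \<le> cmod (z1 * z2) + cmod (z1 * z3) + cmod (z2 * z3)"
    unfolding vieta by (meson norm_triangle_ineq norm_add_leD order_trans add_mono order_refl)
  also have "\<dots> \<le> 3 * Y\<^sup>2" using prod z by (smt (verit))
  finally show "\<bar>real_of_int A\<bar> \<le> 3 * Y\<^sup>2" .
  have "\<bar>real_of_int B\<bar> = cmod (of_int B)" by simp
  also have B: "\<dots> = cmod z1 * cmod z2 * cmod z3" unfolding vieta by (simp add: norm_mult)
  also have "\<dots> \<le> Y * Y * Y" using z Y0 by (intro mult_mono) auto
  finally show "\<bar>real_of_int B\<bar> \<le> Y ^ 3" by (simp add: power3_eq_cube)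
  show "Y > 1"
  proof (rule ccontr)
    assume "\<not> Y > 1"
    then have z1: "cmod z1 < 1" "cmod z2 < 1" "cmod z3 < 1" using z by auto
    have small: "cmod x * cmod y < 1" if "cmod x < 1" "cmod y < 1" for x y
      using mult_strict_mono'[of "cmod x" 1 "cmod y" 1] that by simp
    have "cmod (z1 * z2) < 1" using small z1 by (simp add: norm_mult)
    then have "cmod z1 * cmod z2 * cmod z3 < 1" using small[of "z1 * z2" z3] z1 by (simp add: norm_mult)
    then have "cmod (of_int B) < 1" by (simp only: B)
    then have B0: "B = 0" by simp
    then have "z1 = 0 \<or> z2 = 0 \<or> z3 = 0" using vieta(3) by simp
    \<comment> \<open>One root is zero, so \<open>A\<close> is the product of the other two.\<close>
    then have "cmod (of_int A) < 1" unfolding vieta using small z1 by (auto simp: norm_mult)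
    then have "A = 0" by simp
    then show False using d B0 by (simp add: disc_def)
  qed
qed

text \<open>For \<open>D \<le> 2 * X\<close> the solutions satisfy \<open>u^2 \<le> X\<close>. For
  larger \<open>D\<close> they satisfy \<open>w1 \<le> \<bar>u\<bar> \<le> w2\<close> with
  \<open>w2^2 - w1^2 = 2 * X / 27\<close>, so \<open>w2 - w1\<close> is at most
  \<open>sqrt X\<close>, uniformly in \<open>D\<close>.\<close>

lemma quadratic_small_values:
  fixes D X :: real
  assumes X: "X > 0"
  shows "\<exists>l1 l2. \<forall>u. \<bar>D - 27 * u\<^sup>2\<bar> < X \<longrightarrow> l1 \<le> u \<and> u \<le> l1 + sqrt X \<or> l2 \<le> u \<and> u \<le> l2 + sqrt X"
proof (cases "D \<le> 2 * X")
  case True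
  show ?thesis
  proof (rule exI[of _ 0], rule exI[of _ "- sqrt X"], intro allI impI)
    fix u assume "\<bar>D - 27 * u\<^sup>2\<bar> < X"
    then have "u\<^sup>2 \<le> X" using True X by (simp add: abs_if split: if_splits)
    then have "\<bar>u\<bar> \<le> sqrt X" by (rule real_le_rsqrt[of "\<bar>u\<bar>", simplified])
    then show "0 \<le> u \<and> u \<le> 0 + sqrt X \<or> - sqrt X \<le> u \<and> u \<le> - sqrt X + sqrt X" by auto
  qed
next
  case False
  define w1 where "w1 = sqrt ((D - X) / 27)"
  define w2 where "w2 = sqrt ((D + X) / 27)"
  have w: "w1\<^sup>2 = (D - X) / 27" "w2\<^sup>2 = (D + X) / 27" "w1 \<ge> 0" "w2 \<ge> 0"
    using False X by (simp_all add: w1_def w2_def)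
  have "w2 \<le> w1 + sqrt X"
  proof (rule power2_le_imp_le)
    have "w2\<^sup>2 \<le> w1\<^sup>2 + (sqrt X)\<^sup>2" using w X by simp
    also have "\<dots> \<le> (w1 + sqrt X)\<^sup>2" using w X by (simp add: power2_sum)
    finally show "w2\<^sup>2 \<le> (w1 + sqrt X)\<^sup>2" .
  qed (use w X in simp)
  show ?thesis
  proof (rule exI[of _ w1], rule exI[of _ "- w1 - sqrt X"], intro allI impI)
    fix u assume "\<bar>D - 27 * u\<^sup>2\<bar> < X"
    then have "27 * u\<^sup>2 < D + X" "D - X < 27 * u\<^sup>2" by linarith+
    then have sq: "w1\<^sup>2 \<le> \<bar>u\<bar>\<^sup>2" "\<bar>u\<bar>\<^sup>2 \<le> w2\<^sup>2" unfolding w power2_abs by (simp_all add: field_simps)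
    have "w1 \<le> \<bar>u\<bar>" by (rule power2_le_imp_le[OF sq(1)]) simp
    moreover have "\<bar>u\<bar> \<le> w2" by (rule power2_le_imp_le[OF sq(2) w(4)])
    ultimately have "w1 \<le> \<bar>u\<bar>" "\<bar>u\<bar> \<le> w2" by simp_all
    then show "w1 \<le> u \<and> u \<le> w1 + sqrt X \<or> - w1 - sqrt X \<le> u \<and> u \<le> - w1 - sqrt X + sqrt X"
      using \<open>w2 \<le> w1 + sqrt X\<close> by linarith
  qed
qed

lemma disc_completed_square:
  "real_of_int (disc (t, A, B)) =
    (real_of_int (t\<^sup>2 * A\<^sup>2 - 4 * A ^ 3) + real_of_int (18 * t * A - 4 * t ^ 3) ^ 2 / 108)
    - 27 * (real_of_int B - real_of_int (18 * t * A - 4 * t ^ 3) / 54)\<^sup>2"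
  by (simp add: disc_def field_simps power2_eq_square)

text \<open>The minimum comes from two covers of the same set: one progression in an interval of
  length \<open>2 * Y ^ 3\<close>, and two progressions in intervals of length \<open>sqrt X\<close>
  around the solutions of the quadratic inequality.\<close>

lemma card_B_le:
  fixes X Y :: real
  assumes d: "d > 0" and X: "X > 0" and Y: "Y > 0"
  shows "finite {B::int. \<bar>real_of_int B\<bar> \<le> Y ^ 3 \<and> \<bar>real_of_int (disc (t, A, B))\<bar> < X \<and> d dvd B + c}"
    "real (card {B::int. \<bar>real_of_int B\<bar> \<le> Y ^ 3 \<and> \<bar>real_of_int (disc (t, A, B))\<bar> < X \<and> d dvd B + c})
      \<le> 2 * (min (Y ^ 3) (sqrt X) / d + 1)"
proof -
  define S where "S = {B::int. \<bar>real_of_int B\<bar> \<le> Y ^ 3 \<and> \<bar>real_of_int (disc (t, A, B))\<bar> < X \<and> d dvd B + c}"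
  define P where "P = (\<lambda>lo hi. {x::int. lo \<le> real_of_int x \<and> real_of_int x \<le> hi \<and> d dvd x + c})"
  have P: "finite (P lo hi)" "real (card (P lo hi)) \<le> (hi - lo) / d + 1" if "lo \<le> hi" for lo hi
    using card_progression_le[OF d that, of c] by (simp_all only: P_def)
  have sub: "S \<subseteq> P (- (Y ^ 3)) (Y ^ 3)" unfolding S_def P_def by auto
  have le: "- (Y ^ 3) \<le> Y ^ 3" using Y by simp
  show "finite {B::int. \<bar>real_of_int B\<bar> \<le> Y ^ 3 \<and> \<bar>real_of_int (disc (t, A, B))\<bar> < X \<and> d dvd B + c}"
    using finite_subset[OF sub P(1)[OF le]] unfolding S_def .
  have "real (card S) \<le> real (card (P (- (Y ^ 3)) (Y ^ 3)))"
    using card_mono[OF P(1)[OF le] sub] by simp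
  also have "\<dots> \<le> (Y ^ 3 - - (Y ^ 3)) / d + 1" by (rule P(2)[OF le])
  also have "\<dots> \<le> 2 * (Y ^ 3 / d + 1)" by simp
  finally have 1: "real (card S) \<le> 2 * (Y ^ 3 / d + 1)" .
  define D where "D = real_of_int (t\<^sup>2 * A\<^sup>2 - 4 * A ^ 3) + real_of_int (18 * t * A - 4 * t ^ 3) ^ 2 / 108"
  define b where "b = real_of_int (18 * t * A - 4 * t ^ 3) / 54"
  obtain l1 l2 where l: "\<forall>u. \<bar>D - 27 * u\<^sup>2\<bar> < X \<longrightarrow> l1 \<le> u \<and> u \<le> l1 + sqrt X \<or> l2 \<le> u \<and> u \<le> l2 + sqrt X"
    using quadratic_small_values[OF X, of D] by blast
  define P1 where "P1 = P (l1 + b) (l1 + sqrt X + b)"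
  define P2 where "P2 = P (l2 + b) (l2 + sqrt X + b)"
  have sub2: "S \<subseteq> P1 \<union> P2"
  proof
    fix B assume "B \<in> S"
    then have B: "\<bar>real_of_int (disc (t, A, B))\<bar> < X" "d dvd B + c" by (simp_all add: S_def)
    have "\<bar>D - 27 * (real_of_int B - b)\<^sup>2\<bar> < X"
      using B(1) unfolding disc_completed_square D_def b_def .
    with l have "l1 \<le> B - b \<and> B - b \<le> l1 + sqrt X \<or> l2 \<le> B - b \<and> B - b \<le> l2 + sqrt X" by blast
    then have "l1 + b \<le> B \<and> B \<le> l1 + sqrt X + b \<or> l2 + b \<le> B \<and> B \<le> l2 + sqrt X + b" by linarith
    then show "B \<in> P1 \<union> P2" using B(2) unfolding P1_def P2_def P_def by blast
  qed
  have le2: "l1 + b \<le> l1 + sqrt X + b" "l2 + b \<le> l2 + sqrt X + b" using X by simp_all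
  have fin: "finite P1" "finite P2" unfolding P1_def P2_def by (rule P(1)[OF le2(1)], rule P(1)[OF le2(2)])
  have "card S \<le> card (P1 \<union> P2)" using fin sub2 by (intro card_mono) auto
  also have "\<dots> \<le> card P1 + card P2" by (rule card_Un_le)
  finally have "real (card S) \<le> real (card P1) + real (card P2)" by simp
  moreover have "real (card P1) \<le> sqrt X / d + 1" "real (card P2) \<le> sqrt X / d + 1"
    using P(2)[OF le2(1)] P(2)[OF le2(2)] by (simp_all add: P1_def P2_def)
  ultimately have 2: "real (card S) \<le> 2 * (sqrt X / d + 1)" by simp
  have "real (card S) \<le> 2 * (min (Y ^ 3) (sqrt X) / d + 1)"
    using 1 2 by (simp add: min_def)
  then show "real (card {B::int. \<bar>real_of_int B\<bar> \<le> Y ^ 3 \<and> \<bar>real_of_int (disc (t, A, B))\<bar> < X \<and> d dvd B + c})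
      \<le> 2 * (min (Y ^ 3) (sqrt X) / d + 1)" unfolding S_def .
qed

lemma card_class_le:
  fixes X Y :: real
  assumes n: "n \<ge> 1" and X: "X > 0" and Y: "Y > 1"
  defines "S \<equiv> \<lambda>(t, r). {(t', A, B). t' = t \<and> \<bar>real_of_int A\<bar> \<le> 3 * Y\<^sup>2 \<and> \<bar>real_of_int B\<bar> \<le> Y ^ 3 \<and>
    \<bar>real_of_int (disc (t, A, B))\<bar> < X \<and> deep_root (int n) t A B r}"
  shows "finite (S x)"
    "real (card (S x)) \<le> (12 * (Y\<^sup>2 + real n) * min (Y ^ 3) (sqrt X)) *
        (1 / (real_of_int (modulus_A (int n) x) * modulus_B (int n) x)) + 14 * Y\<^sup>2"
proof -
  have n0: "int n > 0" using n by simp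
  obtain t r where x: "x = (t, r)" by (cases x)
  define dA where "dA = modulus_A (int n) x"
  define dB where "dB = modulus_B (int n) x"
  have pos: "dA > 0" "dB > 0" using modulus_pos[OF n0] by (simp_all add: dA_def dB_def)
  define M where "M = min (Y ^ 3) (sqrt X)"
  have M: "M \<ge> 0" using X Y by (simp add: M_def)
  let ?SA = "{A::int. - (3 * Y\<^sup>2) \<le> A \<and> A \<le> 3 * Y\<^sup>2 \<and> dA dvd A + (3 * r\<^sup>2 + 2 * t * r)}"
  let ?SB = "\<lambda>A. {B::int. \<bar>real_of_int B\<bar> \<le> Y ^ 3 \<and> \<bar>real_of_int (disc (t, A, B))\<bar> < X \<and>
    dB dvd B + (r ^ 3 + t * r\<^sup>2 + A * r)}"
  have eq: "S x = {t} \<times> (SIGMA A:?SA. ?SB A)"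
    unfolding S_def x deep_root_iff dA_def dB_def by (auto simp: abs_le_iff)
  have le: "- (3 * Y\<^sup>2) \<le> 3 * Y\<^sup>2" by simp
  have finA: "finite ?SA" by (rule card_progression_le(1)[OF pos(1) le])
  have finB: "finite (?SB A)" for A using card_B_le(1)[OF pos(2) X, of Y] Y by simp
  show "finite (S x)" unfolding eq by (intro finite_cartesian_product finite_SigmaI finA finB) simp
  have "real (card (S x)) = (\<Sum>A\<in>?SA. real (card (?SB A)))"
    unfolding eq using finA finB by (simp add: card_cartesian_product)
  also have "\<dots> \<le> (\<Sum>A\<in>?SA. 2 * (M / dB + 1))"
    unfolding M_def using card_B_le(2)[OF pos(2) X, of Y] Y by (intro sum_mono) simp
  also have "\<dots> = real (card ?SA) * (2 * (M / dB + 1))" by simp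
  also have "\<dots> \<le> (6 * Y\<^sup>2 / dA + 1) * (2 * (M / dB + 1))"
    using card_progression_le(2)[OF pos(1) le, of "3 * r\<^sup>2 + 2 * t * r"] M pos
    by (intro mult_right_mono) auto
  \<comment> \<open>The term \<open>2 * M / dB\<close> is rewritten over the denominator
    \<open>dA * dB\<close>, so that \<open>dA \<le> n\<close> turns it into \<open>n\<close> times
    the density of the class. The last two terms are the ones charged to each class
    separately.\<close>
  also have "\<dots> = 12 * Y\<^sup>2 * M * (1 / (dA * dB)) + 2 * M * dA * (1 / (dA * dB)) + 12 * Y\<^sup>2 / dA + 2"
    using pos by (simp add: field_simps)
  also have "\<dots> \<le> 12 * Y\<^sup>2 * M * (1 / (dA * dB)) + 12 * M * real n * (1 / (dA * dB)) + 12 * Y\<^sup>2 + 2 * Y\<^sup>2"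
  proof (intro add_mono mult_right_mono)
    have "dA \<le> int n" using modulus_dvd(1)[OF n0, of x] n by (auto simp: dA_def intro: zdvd_imp_le)
    then have "real_of_int dA \<le> real n" by (metis of_int_le_iff of_int_of_nat_eq)
    then show "2 * M * dA \<le> 12 * M * real n"
      using M pos by (intro mult_mono) auto
    show "12 * Y\<^sup>2 / dA \<le> 12 * Y\<^sup>2" using pos by (simp add: divide_le_eq mult_le_cancel_left1)
    show "2 \<le> 2 * Y\<^sup>2" using Y by (simp add: one_le_power)
  qed (use pos M in auto)
  also have "\<dots> = (12 * (Y\<^sup>2 + real n) * M) * (1 / (real_of_int dA * dB)) + 14 * Y\<^sup>2"
    by (simp add: algebra_simps)
  finally show "real (card (S x)) \<le> (12 * (Y\<^sup>2 + real n) * min (Y ^ 3) (sqrt X)) *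
        (1 / (real_of_int (modulus_A (int n) x) * modulus_B (int n) x)) + 14 * Y\<^sup>2"
    by (simp add: M_def dA_def dB_def)
qed

lemma card_Sigma_le:
  fixes n :: nat and X Y :: real
  assumes n: "n \<ge> 1" and X: "X > 0" and Y: "Y > 0"
  shows "real (card {f \<in> Defs.Sigma n. real_of_int \<bar>disc f\<bar> < X \<and> height f < Y})
      \<le> 140 * (nu (Defs.Sigma n) * (Y^2 + real n) * min (Y^3) (sqrt X) + real n * Y^2)"
proof -
  let ?F = "{f \<in> Defs.Sigma n. real_of_int \<bar>disc f\<bar> < X \<and> height f < Y}"
  define M where "M = min (Y ^ 3) (sqrt X)"
  have M: "M \<ge> 0" using X Y by (simp add: M_def)
  have n0: "int n > 0" using n by simp
  have dens: "class_density n \<ge> 0"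
    unfolding class_density_def using modulus_pos[OF n0] by (intro sum_nonneg) (simp add: less_imp_le)
  have nu: "class_density n \<le> 3 * nu (Defs.Sigma n)" "nu (Defs.Sigma n) \<ge> 0"
    using nu_Sigma_ge[OF n] dens by linarith+
  show ?thesis
  \<comment> \<open>A member of the set is needed to obtain \<open>Y > 1\<close>.\<close>
  proof (cases "?F = {}")
    case True
    have "real (card ?F) = 0" by (simp only: True card.empty of_nat_0)
    moreover have "0 \<le> 140 * (nu (Defs.Sigma n) * (Y^2 + real n) * M + real n * Y^2)"
      using nu(2) M by simp
    ultimately show ?thesis by (simp only: M_def)
  next
    case False
    then obtain t A B where "(t, A, B) \<in> ?F" by auto
    then have Y1: "Y > 1" using height_bounds(3)[of t A B Y] by (auto simp: Defs.Sigma_def)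
    define S where "S = (\<lambda>(t, r). {(t', A, B). t' = t \<and> \<bar>real_of_int A\<bar> \<le> 3 * Y\<^sup>2 \<and> \<bar>real_of_int B\<bar> \<le> Y ^ 3 \<and>
      \<bar>real_of_int (disc (t, A, B))\<bar> < X \<and> deep_root (int n) t A B r})"
    note S = card_class_le[OF n X Y1, folded S_def]
    have sub: "?F \<subseteq> (\<Union>x\<in>root_classes (int n). S x)"
    proof
      fix f assume f: "f \<in> ?F"
      obtain t A B where e: "f = (t, A, B)" by (cases f)
      have Sg: "(t, A, B) \<in> Defs.Sigma n" and d: "disc (t, A, B) \<noteq> 0" and t: "t \<in> {-1, 0, 1}"
        and h: "height (t, A, B) < Y" and dX: "\<bar>real_of_int (disc (t, A, B))\<bar> < X"
        using f by (auto simp: e Defs.Sigma_def VZ_def)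
      obtain r where r: "deep_root (int n) t A B r" "(t, r) \<in> root_classes (int n)"
        using exists_deep_root[OF Sg n] t by (auto simp: root_classes_def)
      have "f \<in> S (t, r)" using height_bounds[OF d h] dX r(1) by (simp add: S_def e)
      then show "f \<in> (\<Union>x\<in>root_classes (int n). S x)" using r(2) by blast
    qed
    have fin: "finite (root_classes (int n))" by (rule finite_root_classes[OF n0])
    have "card ?F \<le> card (\<Union>x\<in>root_classes (int n). S x)"
      using S(1) fin by (intro card_mono[OF _ sub]) auto
    also have "\<dots> \<le> (\<Sum>x\<in>root_classes (int n). card (S x))" by (rule card_UN_le[OF fin])
    finally have "real (card ?F) \<le> real (\<Sum>x\<in>root_classes (int n). card (S x))"
      by (simp only: of_nat_le_iff)
    also have "\<dots> = (\<Sum>x\<in>root_classes (int n). real (card (S x)))" by (rule of_nat_sum)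
    also have "\<dots> \<le> (\<Sum>x\<in>root_classes (int n). (12 * (Y\<^sup>2 + real n) * M) *
        (1 / (real_of_int (modulus_A (int n) x) * modulus_B (int n) x)) + 14 * Y\<^sup>2)"
      unfolding M_def by (intro sum_mono S(2))
    also have "\<dots> = 12 * (Y\<^sup>2 + real n) * M * class_density n + real (card (root_classes (int n))) * (14 * Y\<^sup>2)"
      unfolding class_density_def by (simp add: sum.distrib sum_distrib_left)
    \<comment> \<open>The final constant is \<open>140 = 10 * 14\<close>, from the number of classes
      and the error per class; the main term needs only \<open>12 * 3 = 36\<close>.\<close>
    also have "\<dots> \<le> 12 * (Y\<^sup>2 + real n) * M * (3 * nu (Defs.Sigma n)) + 10 * real n * (14 * Y\<^sup>2)"
      using nu(1) card_root_classes[OF n] M dens by (intro add_mono mult_mono) auto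
    also have "\<dots> \<le> 140 * (nu (Defs.Sigma n) * (Y^2 + real n) * M + real n * Y^2)"
    proof -
      have "0 \<le> nu (Defs.Sigma n) * (Y\<^sup>2 + real n) * M" using nu(2) M by simp
      then show ?thesis by (simp add: algebra_simps)
    qed
    finally show ?thesis by (simp add: M_def)
  qed
qed

theorem theorem3p6:
  shows "\<exists>C > 0. \<forall>(n :: nat) (X :: real) (Y :: real). n \<ge> 1 \<longrightarrow> X > 0 \<longrightarrow> Y > 0 \<longrightarrow>
    real (card {f \<in> Sigma n. real_of_int \<bar>disc f\<bar> < X \<and> height f < Y})
      \<le> C * (nu (Sigma n) * (Y^2 + real n) * min (Y^3) (sqrt X) + real n * Y^2)"
  using card_Sigma_le by (intro exI[of _ 140]) simp

end
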